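(* Let $\mathcal{F}$ be the (unitary) Fourier transform on $L^2(\mathbb{R})$, and let $A$ be the restriction of $\mathcal{F}$ to the dense subspace $C_0^{\infty}(\mathbb{R})$, i.e. $D(A)=C_0^\infty(\mathbb{R})$ and $Af=\mathcal{F}f$ for $f\in D(A)$. Define the operator $T$ on $L^2(\mathbb{R})\oplus L^2(\mathbb{R})$ by $$T=\begin{pmatrix}0 & A\\ \frac{1}{2}A & 0\end{pmatrix},\qquad D(T)=C_0^{\infty}(\mathbb{R})\oplus C_0^{\infty}(\mathbb{R}),$$ that is, $T(f,g)=(Ag,\tfrac12 Af)$. Then $T$ is densely defined, closable and paranormal, but its closure $\overline{T}$ is not paranormal. In particular, there exists a densely defined closable paranormal operator whose closure is not paranormal.
   Context: $L^2(\mathbb{R})$ is the complex Hilbert space of square-integrable functions, and $C_0^{\infty}(\mathbb{R})$ is the space of infinitely differentiable functions on $\mathbb{R}$ with compact support. The Fourier transform $\mathcal{F}$ is normalized to be unitary on $L^2(\mathbb{R})$, so $\|\mathcal{F}f\|_2=\|f\|_2$ and $\mathcal{F}^2g(x)=g(-x)$. Linear operators are not necessarily bounded and are defined on a linear subspace $D(\cdot)$ (the domain) of a Hilbert space $H$; $D(T^2)=\{x\in D(T): Tx\in D(T)\}$. An operator $T$ is densely defined if $D(T)$ is dense in $H$. An operator is closed if its graph is closed in $H\oplus H$. We write $A_1\subset A_2$ ($A_2$ extends $A_1$) if $D(A_1)\subset D(A_2)$ and the operators agree on $D(A_1)$. An operator is closable if it has a closed extension; the smallest closed extension (with respect to $\subset$)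 is its closure $\overline{T}$. A linear operator $T:D(T)\subset H\to H$ is called paranormal if $\|Tx\|^2\leq\|T^2x\|\,\|x\|$ for all $x\in D(T^2)$. *)

theory Defs
  imports "HOL-Analysis.Analysis"
begin

section \<open>Complex Hilbert spaces\<close>

text \<open>
  The library only provides real inner product spaces. A complex inner product space is
  a real one, with the real part of the complex inner product as real inner product;
  positive definiteness and the norm are then inherited from \<^class>\<open>real_inner\<close>.
\<close>

class complex_vector = real_vector +
  fixes scaleC :: "complex \<Rightarrow> 'a \<Rightarrow> 'a" (infixr "*\<^sub>C" 75)
  assumes scaleC_add_right: "a *\<^sub>C (x + y) = a *\<^sub>C x + a *\<^sub>C y"
    and scaleC_add_left: "(a + b) *\<^sub>C x = a *\<^sub>C x + b *\<^sub>C x"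
    and scaleC_scaleC: "a *\<^sub>C b *\<^sub>C x = (a * b) *\<^sub>C x"
    and scaleR_scaleC: "scaleR r x = complex_of_real r *\<^sub>C x"

class complex_inner = complex_vector + real_inner +
  fixes cinner :: "'a \<Rightarrow> 'a \<Rightarrow> complex"
  assumes cinner_add_left: "cinner (x + y) z = cinner x z + cinner y z"
    and cinner_scaleC_left: "cinner (a *\<^sub>C x) y = a * cinner x y"
    and cinner_commute: "cinner x y = cnj (cinner y x)"
    and inner_eq_Re_cinner: "x \<bullet> y = Re (cinner x y)"

class chilbert_space = complex_inner + complete_space

text \<open>
  The orthogonal sum of two Hilbert spaces is their product type; its norm is
  the square root of the sum of the squared norms.
\<close>

instantiation prod :: (complex_vector, complex_vector) complex_vector
begin
definition "scaleC a p = (a *\<^sub>C fst p, a *\<^sub>C snd p)"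
instance
  by standard
    (simp_all add: scaleC_prod_def scaleC_add_right scaleC_add_left scaleC_scaleC
      scaleR_prod_def scaleR_scaleC)
end

instantiation prod :: (complex_inner, complex_inner) complex_inner
begin
definition "cinner p q = cinner (fst p) (fst q) + cinner (snd p) (snd q)"
instance
proof
  fix x y z :: "'a \<times> 'b" and a :: complex
  show "cinner (x + y) z = cinner x z + cinner y z"
    by (simp add: cinner_prod_def cinner_add_left)
  show "cinner (a *\<^sub>C x) y = a * cinner x y"
    by (simp add: cinner_prod_def scaleC_prod_def cinner_scaleC_left distrib_left)
  show "cinner x y = cnj (cinner y x)"
    using cinner_commute[of "fst x" "fst y"] cinner_commute[of "snd x" "snd y"]
    by (simp add: cinner_prod_def)
  show "x \<bullet> y = Re (cinner x y)"
    by (simp add: cinner_prod_def inner_prod_def inner_eq_Re_cinner)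
qed
end

instance prod :: (chilbert_space, chilbert_space) chilbert_space ..

section \<open>Unbounded operators\<close>

text \<open>
  An operator is a partial function: its domain is \<^const>\<open>dom\<close>, its graph is
  \<^const>\<open>Map.graph\<close>, and extension of operators is \<^const>\<open>map_le\<close>.
\<close>

type_synonym 'a operator = "'a \<rightharpoonup> 'a"

definition linear_operator :: "'a::complex_vector operator \<Rightarrow> bool" where
  "linear_operator T \<longleftrightarrow>
     0 \<in> dom T \<and>
     (\<forall>x\<in>dom T. \<forall>y\<in>dom T. x + y \<in> dom T \<and> the (T (x + y)) = the (T x) + the (T y)) \<and>
     (\<forall>c. \<forall>x\<in>dom T. c *\<^sub>C x \<in> dom T \<and> the (T (c *\<^sub>C x)) = c *\<^sub>C the (T x))"

definition densely_defined :: "'a::chilbert_space operator \<Rightarrow> bool" where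
  "densely_defined T \<longleftrightarrow> closure (dom T) = UNIV"

definition closed_operator :: "'a::chilbert_space operator \<Rightarrow> bool" where
  "closed_operator T \<longleftrightarrow> linear_operator T \<and> closed (Map.graph T)"

definition closable :: "'a::chilbert_space operator \<Rightarrow> bool" where
  "closable T \<longleftrightarrow> (\<exists>S. closed_operator S \<and> T \<subseteq>\<^sub>m S)"

definition is_operator_closure :: "'a::chilbert_space operator \<Rightarrow> 'a operator \<Rightarrow> bool" where
  "is_operator_closure T S \<longleftrightarrow>
     closed_operator S \<and> T \<subseteq>\<^sub>m S \<and> (\<forall>R. closed_operator R \<and> T \<subseteq>\<^sub>m R \<longrightarrow> S \<subseteq>\<^sub>m R)"

definition operator_closure :: "'a::chilbert_space operator \<Rightarrow> 'a operator" where
  "operator_closure T = (THE S. is_operator_closure T S)"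

text \<open>
  The domain of the composition of partial functions is the natural one, so that
  \<open>dom (T \<circ>\<^sub>m T)\<close> is the set of all \<open>x \<in> dom T\<close> with \<open>the (T x) \<in> dom T\<close>.
\<close>

definition paranormal :: "'a::chilbert_space operator \<Rightarrow> bool" where
  "paranormal T \<longleftrightarrow>
     (\<forall>x \<in> dom (T \<circ>\<^sub>m T). (norm (the (T x)))\<^sup>2 \<le> norm (the ((T \<circ>\<^sub>m T) x)) * norm x)"

lemma is_operator_closure_unique:
  "is_operator_closure T S \<Longrightarrow> is_operator_closure T S' \<Longrightarrow> S = S'"
  unfolding is_operator_closure_def by (blast intro: map_le_antisym)


text \<open>The graph of the closure is the intersection of the graphs of all closed extensions.\<close>

lemma is_operator_closure_operator_closure:
  assumes "closable T"
  shows "is_operator_closure T (operator_closure T)"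
proof -
  define E where "E = {R. closed_operator R \<and> T \<subseteq>\<^sub>m R}"
  from assms obtain R0 where "closed_operator R0" "T \<subseteq>\<^sub>m R0"
    unfolding closable_def by blast
  then have R0: "R0 \<in> E" by (simp add: E_def)
  define S where "S x = (if \<exists>y. \<forall>R\<in>E. R x = Some y then R0 x else None)" for x
  have S_iff: "S x = Some y \<longleftrightarrow> (\<forall>R\<in>E. R x = Some y)" for x y
  proof
    assume *: "S x = Some y"
    have ex: "\<exists>z. \<forall>R\<in>E. R x = Some z"
    proof (rule ccontr)
      assume "\<not> ?thesis"
      then have "S x = None" unfolding S_def by (rule if_not_P)
      with * show False by simp
    qed
    then have S: "S x = R0 x" unfolding S_def by (rule if_P)
    from ex obtain z where z: "\<forall>R\<in>E. R x = Some z" ..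
    then have "R0 x = Some z" using R0 by blast
    with * S have "z = y" by simp
    with z show "\<forall>R\<in>E. R x = Some y" by simp
  next
    assume *: "\<forall>R\<in>E. R x = Some y"
    then have "\<exists>y. \<forall>R\<in>E. R x = Some y" ..
    then have "S x = R0 x" unfolding S_def by (rule if_P)
    with * R0 show "S x = Some y" by simp
  qed
  have lin: "linear_operator R" if "R \<in> E" for R
    using that by (simp add: E_def closed_operator_def)
  have add: "R (x + y) = Some (u + v)"
    if "R \<in> E" "R x = Some u" "R y = Some v" for R x y u v
  proof -
    have "x \<in> dom R" "y \<in> dom R" using that by auto
    then have "x + y \<in> dom R" "the (R (x + y)) = the (R x) + the (R y)"
      using lin[OF that(1)] by (simp_all add: linear_operator_def)
    with that show ?thesis by auto
  qed
  have scale: "R (c *\<^sub>C x) = Some (c *\<^sub>C u)" if "R \<in> E" "R x = Some u" for R c x u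
  proof -
    have "x \<in> dom R" using that by auto
    then have "c *\<^sub>C x \<in> dom R" "the (R (c *\<^sub>C x)) = c *\<^sub>C the (R x)"
      using lin[OF that(1)] by (simp_all add: linear_operator_def)
    with that show ?thesis by auto
  qed
  have zero: "R 0 = Some 0" if R: "R \<in> E" for R
  proof -
    have "0 \<in> dom R" using lin[OF R] by (simp add: linear_operator_def)
    then obtain u where u: "R 0 = Some u" by blast
    with add[OF R u u] show ?thesis by simp
  qed
  have "linear_operator S"
    unfolding linear_operator_def
  proof (intro conjI ballI allI)
    show "0 \<in> dom S" using zero S_iff by blast
    fix x assume "x \<in> dom S"
    then obtain u where u: "S x = Some u" by auto
    show "c *\<^sub>C x \<in> dom S" "the (S (c *\<^sub>C x)) = c *\<^sub>C the (S x)" for c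
    proof -
      have "S (c *\<^sub>C x) = Some (c *\<^sub>C u)" using u by (auto simp: S_iff scale)
      with u show "c *\<^sub>C x \<in> dom S" "the (S (c *\<^sub>C x)) = c *\<^sub>C the (S x)" by auto
    qed
    fix y assume "y \<in> dom S"
    then obtain v where v: "S y = Some v" by auto
    have "S (x + y) = Some (u + v)" using u v by (auto simp: S_iff add)
    with u v show "x + y \<in> dom S" "the (S (x + y)) = the (S x) + the (S y)" by auto
  qed
  moreover have "Map.graph S = (\<Inter>R\<in>E. Map.graph R)"
    by (auto simp: Map.graph_def S_iff)
  then have "closed (Map.graph S)"
    by (auto simp: E_def closed_operator_def)
  moreover have "T \<subseteq>\<^sub>m S"
    unfolding map_le_def
  proof
    fix x assume "x \<in> dom T"
    then obtain y where y: "T x = Some y" by auto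
    then have "S x = Some y" by (force simp: S_iff E_def map_le_def)
    with y show "T x = S x" by simp
  qed
  moreover have "S \<subseteq>\<^sub>m R" if "R \<in> E" for R
    unfolding map_le_def
  proof
    fix x assume "x \<in> dom S"
    then obtain y where y: "S x = Some y" by blast
    then have "R x = Some y" using S_iff that by blast
    with y show "S x = R x" by simp
  qed
  ultimately have S: "is_operator_closure T S"
    by (auto simp: is_operator_closure_def closed_operator_def E_def)
  show ?thesis
    unfolding operator_closure_def
    by (rule theI[where P = "is_operator_closure T", OF S])
      (rule is_operator_closure_unique[OF _ S])
qed

section \<open>The Hilbert space of square-integrable functions on the real line\<close>

definition square_integrable :: "(real \<Rightarrow> complex) \<Rightarrow> bool" where
  "square_integrable f \<longleftrightarrow>
     f \<in> borel_measurable lborel \<and> integrable lborel (\<lambda>x. (cmod (f x))\<^sup>2)"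

lemma square_integrable_measurable [measurable_dest]:
  "square_integrable f \<Longrightarrow> f \<in> borel_measurable lborel"
  by (simp add: square_integrable_def)

lemma square_integrable_zero: "square_integrable (\<lambda>_. 0)"
  by (simp add: square_integrable_def)

lemma square_integrable_add:
  assumes "square_integrable f" "square_integrable g"
  shows "square_integrable (\<lambda>x. f x + g x)"
proof -
  have [measurable]: "f \<in> borel_measurable lborel" "g \<in> borel_measurable lborel"
    using assms by (auto simp: square_integrable_def)
  have "integrable lborel (\<lambda>x. (cmod (f x + g x))\<^sup>2)"
  proof (rule Bochner_Integration.integrable_bound)
    show "integrable lborel (\<lambda>x. 2 * (cmod (f x))\<^sup>2 + 2 * (cmod (g x))\<^sup>2)"
      using assms by (auto simp: square_integrable_def)
    have "(cmod (a + b))\<^sup>2 \<le> 2 * (cmod a)\<^sup>2 + 2 * (cmod b)\<^sup>2" for a b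
    proof -
      have "(cmod (a + b))\<^sup>2 \<le> (cmod a + cmod b)\<^sup>2"
        by (intro power_mono norm_triangle_ineq) simp
      also have "\<dots> \<le> 2 * (cmod a)\<^sup>2 + 2 * (cmod b)\<^sup>2"
        using sum_squares_bound[of "cmod a" "cmod b"] by (simp add: power2_sum)
      finally show ?thesis .
    qed
    then show "AE x in lborel. norm ((cmod (f x + g x))\<^sup>2)
        \<le> norm (2 * (cmod (f x))\<^sup>2 + 2 * (cmod (g x))\<^sup>2)"
      by simp
  qed measurable
  then show ?thesis by (simp add: square_integrable_def)
qed

lemma square_integrable_mult:
  assumes "square_integrable f"
  shows "square_integrable (\<lambda>x. c * f x)"
  using assms by (auto simp: square_integrable_def norm_mult power_mult_distrib)

lemma integrable_mult_cnj:
  assumes "square_integrable f" "square_integrable g"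
  shows "integrable lborel (\<lambda>x. f x * cnj (g x))"
proof (rule Bochner_Integration.integrable_bound)
  have [measurable]: "f \<in> borel_measurable lborel" "g \<in> borel_measurable lborel"
    using assms by (auto simp: square_integrable_def)
  show "integrable lborel (\<lambda>x. (cmod (f x))\<^sup>2 + (cmod (g x))\<^sup>2)"
    using assms by (auto simp: square_integrable_def)
  have "cmod a * cmod b \<le> (cmod a)\<^sup>2 + (cmod b)\<^sup>2" for a b
    using sum_squares_bound[of "cmod a" "cmod b"]
      mult_nonneg_nonneg[OF norm_ge_zero[of a] norm_ge_zero[of b]] by linarith
  then show "AE x in lborel. norm (f x * cnj (g x)) \<le> norm ((cmod (f x))\<^sup>2 + (cmod (g x))\<^sup>2)"
    by (simp add: norm_mult)
  show "(\<lambda>x. f x * cnj (g x)) \<in> borel_measurable lborel"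
    by (intro borel_measurable_times borel_measurable_continuous_on[of cnj] continuous_intros)
      (auto intro!: continuous_intros)
qed

definition l2rel :: "(real \<Rightarrow> complex) \<Rightarrow> (real \<Rightarrow> complex) \<Rightarrow> bool" where
  "l2rel f g \<longleftrightarrow>
     square_integrable f \<and> square_integrable g \<and> (AE x in lborel. f x = g x)"

quotient_type l2 = "real \<Rightarrow> complex" / partial: l2rel
proof (rule part_equivpI)
  show "\<exists>f. l2rel f f"
    using square_integrable_zero by (auto simp: l2rel_def)
  show "symp l2rel"
    by (auto simp: symp_def l2rel_def elim: AE_mp)
  show "transp l2rel"
    unfolding transp_def l2rel_def by (auto elim: eventually_elim2)
qed

instantiation l2 :: complex_vector
begin

lift_definition zero_l2 :: l2 is "\<lambda>_. 0"
  by (simp add: l2rel_def square_integrable_zero)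

lift_definition plus_l2 :: "l2 \<Rightarrow> l2 \<Rightarrow> l2" is "\<lambda>f g x. f x + g x"
  by (auto simp: l2rel_def square_integrable_add elim: eventually_elim2)

lift_definition scaleC_l2 :: "complex \<Rightarrow> l2 \<Rightarrow> l2" is "\<lambda>c f x. c * f x"
  by (auto simp: l2rel_def square_integrable_mult)

definition "scaleR r (f :: l2) = complex_of_real r *\<^sub>C f"
definition "- (f :: l2) = (-1) *\<^sub>C f"
definition "f - (g :: l2) = f + - g"

instance
proof
  fix f g h :: l2 and a b :: complex and r s :: real
  show add_assoc: "f + g + h = f + (g + h)"
    by transfer (auto simp: l2rel_def square_integrable_add add.assoc)
  show add_comm: "f + g = g + f"
    by transfer (auto simp: l2rel_def square_integrable_add add.commute)
  show "0 + f = f"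
    by transfer (auto simp: l2rel_def)
  show "- f + f = 0"
    unfolding uminus_l2_def
    by transfer (auto simp: l2rel_def intro!: square_integrable_zero)
  show "f - g = f + - g" by (simp add: minus_l2_def)
  show C1: "a *\<^sub>C (f + g) = a *\<^sub>C f + a *\<^sub>C g" for a :: complex and f g :: l2
    by transfer
      (auto simp: l2rel_def distrib_left intro!: square_integrable_add square_integrable_mult)
  show C2: "(a + b) *\<^sub>C f = a *\<^sub>C f + b *\<^sub>C f" for a b :: complex and f :: l2
    by transfer
      (auto simp: l2rel_def distrib_right intro!: square_integrable_add square_integrable_mult)
  show C3: "a *\<^sub>C b *\<^sub>C f = (a * b) *\<^sub>C f" for a b :: complex and f :: l2
    by transfer (auto simp: l2rel_def mult.assoc intro!: square_integrable_mult
        dest: square_integrable_mult[of _ "a * b"])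
  show "r *\<^sub>R f = complex_of_real r *\<^sub>C f" by (simp add: scaleR_l2_def)
  show "r *\<^sub>R (f + g) = r *\<^sub>R f + r *\<^sub>R g" by (simp add: scaleR_l2_def C1)
  show "(r + s) *\<^sub>R f = r *\<^sub>R f + s *\<^sub>R f" by (simp add: scaleR_l2_def C2)
  show "r *\<^sub>R s *\<^sub>R f = (r * s) *\<^sub>R f" by (simp add: scaleR_l2_def C3)
  show "1 *\<^sub>R f = f"
    unfolding scaleR_l2_def by transfer (simp add: l2rel_def)
qed

end

instantiation l2 :: complex_inner
begin

lift_definition cinner_l2 :: "l2 \<Rightarrow> l2 \<Rightarrow> complex"
  is "\<lambda>f g. LINT x|lborel. f x * cnj (g x)"
proof -
  fix f f' g g' assume *: "l2rel f f'" "l2rel g g'"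
  then have "AE x in lborel. f x * cnj (g x) = f' x * cnj (g' x)"
    unfolding l2rel_def by (auto elim: eventually_elim2)
  moreover have "integrable lborel (\<lambda>x. f x * cnj (g x))"
      "integrable lborel (\<lambda>x. f' x * cnj (g' x))"
    using * by (auto simp: l2rel_def intro: integrable_mult_cnj)
  ultimately show "(LINT x|lborel. f x * cnj (g x)) = (LINT x|lborel. f' x * cnj (g' x))"
    by (intro integral_cong_AE) auto
qed

definition "f \<bullet> (g :: l2) = Re (cinner f g)"
definition "norm (f :: l2) = sqrt (f \<bullet> f)"
definition "dist f (g :: l2) = norm (f - g)"
definition "sgn (f :: l2) = f /\<^sub>R norm f"
definition "(uniformity :: (l2 \<times> l2) filter) = (INF e\<in>{0 <..}. principal {(x, y). dist x y < e})"
definition "open (U :: l2 set) \<longleftrightarrow> (\<forall>x\<in>U. \<forall>\<^sub>F (x', y) in uniformity. x' = x \<longrightarrow> y \<in> U)"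

instance
proof
  fix f g h :: l2 and a :: complex and r :: real and U :: "l2 set"
  show add: "cinner (f + g) h = cinner f h + cinner g h"
    by transfer (auto simp: l2rel_def distrib_right integrable_mult_cnj)
  show scale: "cinner (a *\<^sub>C f) g = a * cinner f g" for a
    by transfer (simp add: mult.assoc)
  show commute: "cinner f g = cnj (cinner g f)" for f g :: l2
    by transfer
      (subst Bochner_Integration.integral_cnj[symmetric], simp add: mult.commute)
  show "f \<bullet> g = Re (cinner f g)" by (simp add: inner_l2_def)
  show "f \<bullet> g = g \<bullet> f"
    using commute[of f g] by (simp add: inner_l2_def)
  show "(f + g) \<bullet> h = f \<bullet> h + g \<bullet> h" by (simp add: inner_l2_def add)
  show "(r *\<^sub>R f) \<bullet> g = r * (f \<bullet> g)" by (simp add: inner_l2_def scaleR_l2_def scale)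
  have sq: "Re (LINT x|lborel. k x * cnj (k x)) = (LINT x|lborel. (cmod (k x))\<^sup>2)"
    for k :: "real \<Rightarrow> complex"
    by (simp add: complex_norm_square[symmetric] del: of_real_power)
  show "0 \<le> f \<bullet> f"
    unfolding inner_l2_def by transfer (simp add: sq)
  show "f \<bullet> f = 0 \<longleftrightarrow> f = 0"
    unfolding inner_l2_def
  proof transfer
    fix k assume "l2rel k k"
    then have "square_integrable k" by (simp add: l2rel_def)
    then show "(Re (LINT x|lborel. k x * cnj (k x)) = 0) = l2rel k (\<lambda>_. 0)"
      unfolding sq by (subst integral_nonneg_eq_0_iff_AE)
        (auto simp: l2rel_def square_integrable_def)
  qed
qed (simp_all add: norm_l2_def dist_l2_def sgn_l2_def uniformity_l2_def open_l2_def)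

end


lemma l2rel_self_iff: "l2rel f f \<longleftrightarrow> square_integrable f"
  by (simp add: l2rel_def)

lemma square_integrable_rep_l2: "square_integrable (rep_l2 f)"
  using Quotient3_rel_rep[OF Quotient3_l2, of f f] by (simp add: l2rel_def)

lemma abs_rep_l2: "abs_l2 (rep_l2 f) = f"
  by (rule Quotient3_abs_rep[OF Quotient3_l2])

lemma abs_l2_diff:
  assumes "square_integrable f" "square_integrable g"
  shows "abs_l2 f - abs_l2 g = abs_l2 (\<lambda>x. f x - g x)"
proof -
  have "square_integrable (\<lambda>x. -1 * g x)"
    by (intro square_integrable_mult assms)
  then show ?thesis
    using assms unfolding minus_l2_def uminus_l2_def
    by (simp add: scaleC_l2.abs_eq plus_l2.abs_eq l2rel_self_iff)
qed

lemma norm_abs_l2: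
  assumes "square_integrable f"
  shows "(norm (abs_l2 f))\<^sup>2 = (LINT x|lborel. (cmod (f x))\<^sup>2)"
proof -
  have "(norm (abs_l2 f))\<^sup>2 = Re (LINT x|lborel. f x * cnj (f x))"
    using assms
    by (simp add: power2_norm_eq_inner inner_l2_def cinner_l2.abs_eq l2rel_self_iff)
  also have "\<dots> = (LINT x|lborel. (cmod (f x))\<^sup>2)"
    by (simp add: complex_norm_square[symmetric] del: of_real_power)
  finally show ?thesis .
qed

lemma square_integrable_diff:
  assumes "square_integrable f" "square_integrable g"
  shows "square_integrable (\<lambda>x. f x - g x)"
  using square_integrable_add[OF assms(1) square_integrable_mult[OF assms(2), of "-1"]] by simp

lemma nn_integral_square_integrable:
  assumes "square_integrable f"
  shows "(\<integral>\<^sup>+x. ennreal ((cmod (f x))\<^sup>2) \<partial>lborel) = ennreal ((norm (abs_l2 f))\<^sup>2)"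
  using assms by (subst nn_integral_eq_integral) (auto simp: square_integrable_def norm_abs_l2)

lemma square_integrableI:
  assumes "f \<in> borel_measurable lborel"
    and "(\<integral>\<^sup>+x. ennreal ((cmod (f x))\<^sup>2) \<partial>lborel) < \<infinity>"
  shows "square_integrable f"
  unfolding square_integrable_def using assms by (auto intro!: integrableI_nonneg)

text \<open>Riesz--Fischer\<close>

lemma AE_convergent_fast_Cauchy:
  assumes sq: "\<And>n. square_integrable (F n)"
    and fast: "\<And>n. norm (abs_l2 (\<lambda>x. F (Suc n) x - F n x)) \<le> (1/3) ^ n"
  shows "AE x in lborel. convergent (\<lambda>n. F n x)"
proof -
  have [measurable]: "F n \<in> borel_measurable lborel" for n
    using sq by (auto simp: square_integrable_def)
  define h where "h n x = F (Suc n) x - F n x" for n x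
  have [measurable]: "h n \<in> borel_measurable lborel" for n
    unfolding h_def by measurable
  have int: "(\<integral>\<^sup>+x. ennreal (4 ^ n * (cmod (h n x))\<^sup>2) \<partial>lborel) \<le> ennreal ((4/9) ^ n)" for n
  proof -
    have "(\<integral>\<^sup>+x. ennreal (4 ^ n * (cmod (h n x))\<^sup>2) \<partial>lborel)
        = ennreal (4 ^ n) * (\<integral>\<^sup>+x. ennreal ((cmod (h n x))\<^sup>2) \<partial>lborel)"
      by (simp add: ennreal_mult nn_integral_cmult)
    also have "\<dots> = ennreal (4 ^ n * (norm (abs_l2 (h n)))\<^sup>2)"
      unfolding h_def
      by (subst nn_integral_square_integrable) (auto simp: ennreal_mult intro: square_integrable_diff sq)
    also have "\<dots> \<le> ennreal (4 ^ n * ((1/3) ^ n)\<^sup>2)"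
      using fast[of n] unfolding h_def
      by (intro ennreal_leI mult_left_mono power_mono) auto
    also have "4 ^ n * ((1/3) ^ n)\<^sup>2 = (4/9 :: real) ^ n"
      unfolding power2_eq_square power_mult_distrib[symmetric] by simp
    finally show ?thesis .
  qed
  have "(\<integral>\<^sup>+x. (\<Sum>n. ennreal (4 ^ n * (cmod (h n x))\<^sup>2)) \<partial>lborel)
      = (\<Sum>n. \<integral>\<^sup>+x. ennreal (4 ^ n * (cmod (h n x))\<^sup>2) \<partial>lborel)"
    by (intro nn_integral_suminf) measurable
  also have "\<dots> \<le> (\<Sum>n. ennreal ((4/9) ^ n))"
    by (intro suminf_le int) auto
  also have "\<dots> = ennreal (\<Sum>n. (4/9) ^ n)"
    by (intro suminf_ennreal2) auto
  finally have "(\<integral>\<^sup>+x. (\<Sum>n. ennreal (4 ^ n * (cmod (h n x))\<^sup>2)) \<partial>lborel) < \<infinity>"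
    by (rule le_less_trans) (simp only: infinity_ennreal_def ennreal_less_top)
  then have "(\<integral>\<^sup>+x. (\<Sum>n. ennreal (4 ^ n * (cmod (h n x))\<^sup>2)) \<partial>lborel) \<noteq> \<infinity>"
    by (rule less_imp_neq)
  with _ have "AE x in lborel. (\<Sum>n. ennreal (4 ^ n * (cmod (h n x))\<^sup>2)) \<noteq> \<infinity>"
    by (rule nn_integral_noteq_infinite) measurable
  then show ?thesis
  proof eventually_elim
    case (elim x)
    then have "summable (\<lambda>n. 4 ^ n * (cmod (h n x))\<^sup>2)"
      by (intro summable_suminf_not_top) auto
    then have "Bseq (\<lambda>n. 4 ^ n * (cmod (h n x))\<^sup>2)"
      by (intro convergent_imp_Bseq) (auto simp: convergent_def dest: summable_LIMSEQ_zero)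
    then obtain K where K: "K > 0" "\<And>n. 4 ^ n * (cmod (h n x))\<^sup>2 \<le> K"
      by (auto elim!: BseqE simp: abs_mult)
    have "cmod (h n x) \<le> sqrt K * (1/2) ^ n" for n
    proof -
      have two: "(2 ^ n)\<^sup>2 = (4::real) ^ n"
        by (simp add: power2_eq_square flip: power_mult_distrib)
      have "(cmod (h n x) * 2 ^ n)\<^sup>2 \<le> K"
        using K(2)[of n] two by (simp add: power_mult_distrib mult.commute)
      then have "cmod (h n x) * 2 ^ n \<le> sqrt K" by (rule real_le_rsqrt)
      then show ?thesis by (simp add: power_divide pos_le_divide_eq)
    qed
    then have "cmod (h n x) \<le> sqrt K * (1/2) ^ n" if "n \<ge> 0" for n by blast
    moreover have "summable (\<lambda>n. sqrt K * (1/2) ^ n)"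
      by (intro summable_mult summable_geometric) simp
    ultimately have "summable (\<lambda>n. h n x)"
      by (rule summable_comparison_test'[rotated])
    then have "convergent (\<lambda>n. \<Sum>k<n. h k x)"
      by (simp add: summable_iff_convergent)
    moreover have "(\<Sum>k<n. h k x) = F n x - F 0 x" for n
      unfolding h_def by (rule sum_lessThan_telescope)
    ultimately have "convergent (\<lambda>n. (F n x - F 0 x) + F 0 x)"
      by (intro convergent_add convergent_const) simp
    then show ?case by simp
  qed
qed

instance l2 :: complete_space
proof
  fix X :: "nat \<Rightarrow> l2" assume X: "Cauchy X"
  define F where "F n = rep_l2 (X n)" for n
  have sq: "square_integrable (F n)" and X_eq: "X n = abs_l2 (F n)" for n
    by (simp_all add: F_def square_integrable_rep_l2 abs_rep_l2)
  have [measurable]: "F n \<in> borel_measurable lborel" for n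
    using sq by (auto simp: square_integrable_def)
  have "\<forall>k. \<exists>N. \<forall>m\<ge>N. \<forall>n\<ge>N. norm (X m - X n) < (1/3) ^ k"
    using X by (auto simp: Cauchy_iff)
  then obtain N where N: "\<And>k m n. m \<ge> N k \<Longrightarrow> n \<ge> N k \<Longrightarrow> norm (X m - X n) < (1/3) ^ k"
    by metis
  define r where "r k = (\<Sum>j\<le>k. N j) + k" for k
  have r_ge: "N k \<le> r k" "k \<le> r k" for k
    using member_le_sum[of k "{..k}" N] by (auto simp: r_def)
  have "r k \<le> r (Suc k)" for k by (simp add: r_def)
  then have "norm (X (r (Suc k)) - X (r k)) \<le> (1/3) ^ k" for k
    using r_ge(1)[of k] N[of k "r (Suc k)" "r k"] by (meson less_imp_le order.trans)
  then have AE_conv: "AE x in lborel. convergent (\<lambda>k. F (r k) x)"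
    by (intro AE_convergent_fast_Cauchy sq) (simp add: X_eq abs_l2_diff sq)
  define f where "f x = lim (\<lambda>k. F (r k) x)" for x
  have [measurable]: "f \<in> borel_measurable lborel"
    unfolding f_def by measurable
  have bound: "(\<integral>\<^sup>+x. ennreal ((cmod (f x - F m x))\<^sup>2) \<partial>lborel) \<le> ennreal (e\<^sup>2)"
    if e: "\<And>m n. m \<ge> M \<Longrightarrow> n \<ge> M \<Longrightarrow> norm (X m - X n) < e" and m: "m \<ge> M" for e m M
  proof -
    have "(\<integral>\<^sup>+x. ennreal ((cmod (f x - F m x))\<^sup>2) \<partial>lborel)
        = (\<integral>\<^sup>+x. liminf (\<lambda>k. ennreal ((cmod (F (r k) x - F m x))\<^sup>2)) \<partial>lborel)"
      using AE_conv
    proof (intro nn_integral_cong_AE, eventually_elim)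
      case (elim x)
      then have "(\<lambda>k. F (r k) x) \<longlonglongrightarrow> f x"
        by (simp add: f_def convergent_LIMSEQ_iff)
      then have "(\<lambda>k. ennreal ((cmod (F (r k) x - F m x))\<^sup>2))
          \<longlonglongrightarrow> ennreal ((cmod (f x - F m x))\<^sup>2)"
        by (intro tendsto_intros)
      then show ?case by (intro lim_imp_Liminf[symmetric]) auto
    qed
    also have "\<dots> \<le> liminf (\<lambda>k. \<integral>\<^sup>+x. ennreal ((cmod (F (r k) x - F m x))\<^sup>2) \<partial>lborel)"
      by (intro nn_integral_liminf) measurable
    also have "\<dots> = liminf (\<lambda>k. ennreal ((norm (X (r k) - X m))\<^sup>2))"
      by (subst nn_integral_square_integrable) (auto simp: X_eq abs_l2_diff sq square_integrable_diff)
    also have "\<dots> \<le> liminf (\<lambda>k::nat. ennreal (e\<^sup>2))"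
    proof (intro Liminf_mono eventually_sequentiallyI[of M])
      fix k assume "M \<le> k"
      then have "norm (X (r k) - X m) < e"
        using r_ge(2)[of k] m by (intro e) auto
      then show "ennreal ((norm (X (r k) - X m))\<^sup>2) \<le> ennreal (e\<^sup>2)"
        by (intro ennreal_leI power_mono) auto
    qed
    finally show ?thesis by (simp add: Liminf_const)
  qed
  have diff: "square_integrable (\<lambda>x. f x - F m x)"
    if "\<And>m n. m \<ge> M \<Longrightarrow> n \<ge> M \<Longrightarrow> norm (X m - X n) < e" "m \<ge> M" for e m M
    using bound[OF that] by (intro square_integrableI) (auto simp: le_less_trans)
  have "square_integrable (\<lambda>x. f x - F (N 0) x)"
    using N[of 0] by (rule diff) auto
  from square_integrable_add[OF this sq[of "N 0"]] have f: "square_integrable f" by simp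
  have "X \<longlonglongrightarrow> abs_l2 f"
  proof (rule LIMSEQ_I)
    fix e :: real assume "e > 0"
    then have "e / 2 > 0" by simp
    from X[unfolded Cauchy_iff, rule_format, OF this]
    obtain M where M: "\<And>m n. m \<ge> M \<Longrightarrow> n \<ge> M \<Longrightarrow> norm (X m - X n) < e / 2"
      by auto
    have "norm (X m - abs_l2 f) < e" if "m \<ge> M" for m
    proof -
      have "ennreal ((norm (abs_l2 f - X m))\<^sup>2) \<le> ennreal ((e / 2)\<^sup>2)"
        using bound[OF M that] nn_integral_square_integrable[OF diff[OF M that]]
        unfolding X_eq abs_l2_diff[OF f sq] by simp
      then have "(norm (abs_l2 f - X m))\<^sup>2 \<le> (e / 2)\<^sup>2"
        by (simp add: ennreal_le_iff)
      then have "norm (abs_l2 f - X m) \<le> e / 2"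
        by (rule power2_le_imp_le) (use \<open>e > 0\<close> in simp)
      then show ?thesis using \<open>e > 0\<close> by (simp add: norm_minus_commute)
    qed
    then show "\<exists>M. \<forall>m\<ge>M. norm (X m - abs_l2 f) < e" by blast
  qed
  then show "convergent X" by (auto simp: convergent_def)
qed

instance l2 :: chilbert_space ..

section \<open>The Fourier transform\<close>

definition fourier_integral :: "(real \<Rightarrow> complex) \<Rightarrow> real \<Rightarrow> complex" where
  "fourier_integral f \<xi> =
     complex_of_real (1 / sqrt (2 * pi)) * (LINT x|lborel. f x * cis (- (x * \<xi>)))"

text \<open>
  A square-integrable function need not be integrable. Its Fourier transform is the limit,
  in \<open>L\<^sup>2\<close>, of the Fourier integrals of its truncations to \<open>[-n, n]\<close>, which are integrable;
  by Plancherel's theorem these integrals are square-integrable and the limit exists.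
\<close>

definition fourier :: "l2 \<Rightarrow> l2" where
  "fourier f =
     lim (\<lambda>n. abs_l2 (fourier_integral (\<lambda>x. indicator {- real n..real n} x * rep_l2 f x)))"

definition smooth :: "(real \<Rightarrow> complex) \<Rightarrow> bool" where
  "smooth f \<longleftrightarrow> (\<forall>k x. ((\<lambda>g t. vector_derivative g (at t)) ^^ k) f differentiable at x)"

definition test_functions :: "l2 set" where
  "test_functions = {abs_l2 \<phi> | \<phi>. smooth \<phi> \<and> compact (closure {x. \<phi> x \<noteq> 0})}"

section \<open>The operators\<close>

definition op_A :: "l2 operator" where
  "op_A = (\<lambda>f. Some (fourier f)) |` test_functions"

definition op_T :: "(l2 \<times> l2) operator" where
  "op_T = (\<lambda>(f, g). Some (the (op_A g), (1/2) *\<^sub>C the (op_A f)))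
            |` (test_functions \<times> test_functions)"

end

theory Submission
  imports Defs
    "HOL-Probability.Characteristic_Functions"
    "HOL-Complex_Analysis.Conformal_Mappings"
begin

text \<open>
  On test functions the Fourier transform is isometric and its range meets the test
  functions only in \<open>0\<close>. These two facts carry the theorem.

  Since a nonzero function and its Fourier transform cannot both have compact support
  (\<open>test_function_and_fourier_imp_zero\<close>), the domain of \<open>T\<^sup>2\<close> is \<open>{0}\<close>, and
  \<open>T\<close> is paranormal for a trivial reason. Taking the closure destroys this: \<open>T\<close> is bounded
  and densely defined, so its closure \<open>B\<close> is everywhere defined and continuous
  (\<open>bounded_operator_closure\<close>), and by continuity \<open>B (f, g)\<close> has components of norms
  \<open>\<parallel>g\<parallel>\<close> and \<open>\<parallel>f\<parallel> / 2\<close>. Hence \<open>\<parallel>B (0, g)\<parallel> = \<parallel>g\<parallel>\<close> but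
  \<open>\<parallel>B (B (0, g))\<parallel> = \<parallel>g\<parallel> / 2\<close>, which contradicts paranormality for \<open>g \<noteq> 0\<close>.

  Three analytic facts are needed. Test functions are dense (\<open>closure_test_functions\<close>), because
  products of functions \<open>exp (-1/x)\<close> approximate indicators of intervals, and these generate
  the space. Plancherel's theorem for continuous functions of compact support
  (\<open>plancherel\<close>) follows by averaging the squared modulus of the transform against wide
  Gaussians, whose own transforms are known. The uncertainty principle
  (\<open>fourier_integral_uncertainty\<close>) holds because the Fourier integral of a compactly
  supported function is entire.
\<close>

section \<open>Closures of bounded operators\<close>

lemma norm_scaleC: "norm (c *\<^sub>C (x :: 'a::complex_inner)) = cmod c * norm x"
proof -
  have "cinner x x = cnj (cinner x x)" by (rule cinner_commute)
  then have im: "Im (cinner x x) = 0" by (metis Reals_cnj_iff complex_is_Real_iff)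
  have "cinner (c *\<^sub>C x) (c *\<^sub>C x) = c * cnj (cinner (c *\<^sub>C x) x)"
    using cinner_commute[of x "c *\<^sub>C x"] by (simp add: cinner_scaleC_left)
  also have "\<dots> = c * cnj c * cnj (cinner x x)" by (simp add: cinner_scaleC_left)
  also have "\<dots> = complex_of_real ((cmod c)\<^sup>2) * cnj (cinner x x)"
    by (simp only: complex_norm_square)
  finally have "(norm (c *\<^sub>C x))\<^sup>2 = (cmod c * norm x)\<^sup>2"
    by (simp add: power2_norm_eq_inner inner_eq_Re_cinner power_mult_distrib im)
  then show ?thesis by simp
qed

lemma scaleC_minus_one: "(-1) *\<^sub>C x = - (x :: 'a::complex_vector)"
  using scaleR_scaleC[of "-1" x] by simp

lemma tendsto_scaleC:
  fixes x :: "'a::complex_inner"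
  assumes "(f \<longlongrightarrow> x) F"
  shows "((\<lambda>n. c *\<^sub>C f n) \<longlongrightarrow> c *\<^sub>C x) F"
proof -
  have eq: "c *\<^sub>C u - c *\<^sub>C v = c *\<^sub>C (u - v)" for u v :: 'a
    using scaleC_add_right[of c "u - v" v] by (simp add: algebra_simps)
  have "((\<lambda>n. cmod c * norm (f n - x)) \<longlongrightarrow> cmod c * 0) F"
    using assms by (intro tendsto_mult tendsto_const) (simp add: LIM_zero tendsto_norm_zero)
  then have "((\<lambda>n. norm (c *\<^sub>C f n - c *\<^sub>C x)) \<longlongrightarrow> 0) F"
    by (simp add: eq norm_scaleC)
  then show ?thesis
    by (rule LIM_zero_cancel[OF tendsto_norm_zero_cancel])
qed

text \<open>
  The continuous extension to the whole space has a closed graph, and every closed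
  extension of the operator contains the closure of the given graph, which is already
  the graph of the continuous extension.
\<close>

lemma bounded_operator_closure:
  fixes T :: "'a::chilbert_space operator"
  assumes lin: "linear_operator T" and dense: "densely_defined T"
    and bounded: "\<And>x. x \<in> dom T \<Longrightarrow> norm (the (T x)) \<le> C * norm x"
  shows "closable T" and "\<exists>B. continuous_on UNIV B \<and> (\<forall>x\<in>dom T. T x = Some (B x)) \<and>
    operator_closure T = (\<lambda>x. Some (B x))"
proof -
  let ?t = "\<lambda>x. the (T x)"
  have cl: "closure (dom T) = UNIV" using dense by (simp add: densely_defined_def)
  have add: "x + y \<in> dom T" "?t (x + y) = ?t x + ?t y" if "x \<in> dom T" "y \<in> dom T" for x y
    using lin that unfolding linear_operator_def by blast+
  have scale: "c *\<^sub>C x \<in> dom T" "?t (c *\<^sub>C x) = c *\<^sub>C ?t x" if "x \<in> dom T" for c x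
    using lin that unfolding linear_operator_def by blast+
  have diff: "norm (?t x - ?t y) \<le> C * norm (x - y)" if "x \<in> dom T" "y \<in> dom T" for x y
  proof -
    have y: "- y \<in> dom T" "?t (- y) = - ?t y"
      using scale[OF that(2), of "-1"] by (simp_all add: scaleC_minus_one)
    have "x - y \<in> dom T" "?t (x - y) = ?t x - ?t y"
      using add[OF that(1) y(1)] y(2) by simp_all
    with bounded[of "x - y"] show ?thesis by simp
  qed
  have "uniformly_continuous_on (dom T) ?t"
  unfolding uniformly_continuous_on_def
  proof (intro allI impI)
    fix e :: real assume e: "e > 0"
    show "\<exists>d>0. \<forall>x\<in>dom T. \<forall>x'\<in>dom T. dist x' x < d \<longrightarrow> dist (?t x') (?t x) < e"
    proof (intro exI[of _ "e / (\<bar>C\<bar> + 1)"] conjI ballI impI)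
      show "e / (\<bar>C\<bar> + 1) > 0" using e by simp
      fix x y assume xy: "x \<in> dom T" "y \<in> dom T" "dist y x < e / (\<bar>C\<bar> + 1)"
      have "dist (?t y) (?t x) \<le> C * norm (y - x)"
        using diff[OF xy(2,1)] by (simp add: dist_norm)
      also have "\<dots> \<le> (\<bar>C\<bar> + 1) * norm (y - x)"
        by (intro mult_right_mono) auto
      also have "\<dots> < e" using xy(3) by (simp add: dist_norm field_simps)
      finally show "dist (?t y) (?t x) < e" .
    qed
  qed
  then have "\<exists>B. uniformly_continuous_on (closure (dom T)) B \<and> (\<forall>x\<in>dom T. ?t x = B x)"
    by (rule uniformly_continuous_on_extension_on_closure) (intro exI conjI ballI)
  then obtain B where ucB: "uniformly_continuous_on (closure (dom T)) B"
    and TB: "\<And>x. x \<in> dom T \<Longrightarrow> ?t x = B x"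
    by metis
  have cont: "continuous_on UNIV B"
    using ucB cl by (simp add: uniformly_continuous_imp_continuous)
  have lim: "(\<lambda>n. B (s n)) \<longlonglongrightarrow> B x" if "s \<longlonglongrightarrow> x" for s x
    using continuous_on_tendsto_compose[OF cont that] by simp
  have T_eq: "T x = Some (B x)" if "x \<in> dom T" for x
    using that TB by force
  have seq: "\<exists>s. (\<forall>n. s n \<in> dom T) \<and> s \<longlonglongrightarrow> x" for x
    using cl closure_sequential[of x "dom T"] by auto
  define S where "S = (\<lambda>x. Some (B x))"
  have "linear_operator S"
    unfolding linear_operator_def
  proof (intro conjI ballI allI)
    fix x y :: 'a and c
    obtain s where s: "\<And>n. s n \<in> dom T" "s \<longlonglongrightarrow> x" using seq by metis
    obtain r where r: "\<And>n. r n \<in> dom T" "r \<longlonglongrightarrow> y" using seq by metis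
    have "B (s n + r n) = B (s n) + B (r n)" for n
      using add[OF s(1)[of n] r(1)[of n]] by (simp add: TB s(1) r(1))
    moreover have "(\<lambda>n. B (s n + r n)) \<longlonglongrightarrow> B (x + y)"
      by (intro lim tendsto_add s r)
    ultimately have "(\<lambda>n. B (s n) + B (r n)) \<longlonglongrightarrow> B (x + y)" by simp
    moreover have "(\<lambda>n. B (s n) + B (r n)) \<longlonglongrightarrow> B x + B y"
      by (intro lim tendsto_add s r)
    ultimately show "the (S (x + y)) = the (S x) + the (S y)"
      unfolding S_def option.sel by (rule LIMSEQ_unique)
    have "B (c *\<^sub>C s n) = c *\<^sub>C B (s n)" for n
      using scale[OF s(1)[of n], of c] by (simp add: TB s(1))
    moreover have "(\<lambda>n. B (c *\<^sub>C s n)) \<longlonglongrightarrow> B (c *\<^sub>C x)"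
      by (intro lim tendsto_scaleC s)
    ultimately have "(\<lambda>n. c *\<^sub>C B (s n)) \<longlonglongrightarrow> B (c *\<^sub>C x)" by simp
    moreover have "(\<lambda>n. c *\<^sub>C B (s n)) \<longlonglongrightarrow> c *\<^sub>C B x"
      by (intro lim tendsto_scaleC s)
    ultimately show "the (S (c *\<^sub>C x)) = c *\<^sub>C the (S x)"
      unfolding S_def option.sel by (rule LIMSEQ_unique)
  qed (auto simp: S_def)
  moreover have "closed (Map.graph S)"
  proof -
    have "Map.graph S = {p. snd p = B (fst p)}"
      by (auto simp: Map.graph_def S_def)
    moreover have "continuous_on UNIV (\<lambda>p :: 'a \<times> 'a. B (fst p))"
      using continuous_on_compose2[OF cont, of UNIV fst] by (simp add: continuous_on_fst)
    then have "closed {p. snd p = B (fst p)}"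
      by (intro closed_Collect_eq continuous_on_snd continuous_on_id)
    ultimately show ?thesis by simp
  qed
  ultimately have clS: "closed_operator S" by (simp add: closed_operator_def)
  have TS: "T \<subseteq>\<^sub>m S" by (auto simp: map_le_def S_def T_eq)
  show closable: "closable T" using clS TS by (auto simp: closable_def)
  have "S \<subseteq>\<^sub>m R" if R: "closed_operator R" "T \<subseteq>\<^sub>m R" for R
  proof -
    have "R x = Some (B x)" for x
    proof -
      obtain s where s: "\<And>n. s n \<in> dom T" "s \<longlonglongrightarrow> x" using seq by metis
      have "R (s n) = Some (B (s n))" for n
        using R(2) s(1)[of n] T_eq[OF s(1)[of n]] by (simp add: map_le_def)
      then have "(s n, B (s n)) \<in> Map.graph R" for n
        by (simp add: Map.graph_def)
      then have "(x, B x) \<in> Map.graph R"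
      proof (rule closed_sequentially[rotated])
        show "closed (Map.graph R)" using R(1) by (simp add: closed_operator_def)
        show "(\<lambda>n. (s n, B (s n))) \<longlonglongrightarrow> (x, B x)"
          by (intro tendsto_Pair lim s)
      qed
      then show ?thesis by (simp add: Map.graph_def)
    qed
    then show ?thesis by (simp add: map_le_def S_def)
  qed
  then have "is_operator_closure T S"
    using clS TS by (simp add: is_operator_closure_def)
  then have "operator_closure T = S"
    by (rule is_operator_closure_unique[OF is_operator_closure_operator_closure[OF closable]])
  with cont T_eq show "\<exists>B. continuous_on UNIV B \<and> (\<forall>x\<in>dom T. T x = Some (B x)) \<and>
      operator_closure T = (\<lambda>x. Some (B x))"
    unfolding S_def by blast
qed

section \<open>Smooth functions\<close>

text \<open>
  Smoothness is coinductive: it suffices to exhibit a family of functions that contains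
  the given one and is stable under differentiation. Differentiating a concrete function once
  usually reveals such a family.
\<close>

lemma smooth_coinduct:
  assumes "f \<in> S" and S: "\<And>g. g \<in> S \<Longrightarrow> \<exists>g'\<in>S. \<forall>x. (g has_vector_derivative g' x) (at x)"
  shows "smooth f"
proof -
  let ?D = "\<lambda>g t. vector_derivative g (at t)"
  have "(?D ^^ k) f \<in> S" for k
  proof (induction k)
    case (Suc k)
    then obtain g' where g': "g' \<in> S" "\<And>x. ((?D ^^ k) f has_vector_derivative g' x) (at x)"
      using S by blast
    then have "(?D ^^ Suc k) f = g'"
      by (auto simp: fun_eq_iff intro!: vector_derivative_at)
    with g' show ?case by simp
  qed (use assms in simp)
  with S show ?thesis
    unfolding smooth_def by (meson differentiableI_vector)
qed

lemma smooth_has_derivative: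
  assumes "smooth f"
  shows "\<exists>f'. smooth f' \<and> (\<forall>x. (f has_vector_derivative f' x) (at x))"
proof (intro exI conjI allI)
  let ?f' = "\<lambda>t. vector_derivative f (at t)"
  show "smooth ?f'"
    unfolding smooth_def
  proof (intro allI)
    fix k x
    show "((\<lambda>g t. vector_derivative g (at t)) ^^ k) ?f' differentiable at x"
      using assms[unfolded smooth_def, rule_format, of "Suc k" x]
      by (simp only: funpow_Suc_right o_apply)
  qed
  show "(f has_vector_derivative ?f' x) (at x)" for x
    using assms[unfolded smooth_def, rule_format, of 0 x]
    by (simp add: vector_derivative_works)
qed

text \<open>
  By the sum and product rules, an algebra of functions is stable under differentiation as
  soon as the derivatives of its generators lie in it. With all smooth functions as
  generators this shows that smooth functions are closed under sums and products.
\<close>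

inductive_set diff_algebra :: "(real \<Rightarrow> complex) set \<Rightarrow> (real \<Rightarrow> complex) set"
  for G where
  gen: "g \<in> G \<Longrightarrow> g \<in> diff_algebra G"
| const: "(\<lambda>x. c) \<in> diff_algebra G"
| add: "f \<in> diff_algebra G \<Longrightarrow> g \<in> diff_algebra G \<Longrightarrow> (\<lambda>x. f x + g x) \<in> diff_algebra G"
| mult: "f \<in> diff_algebra G \<Longrightarrow> g \<in> diff_algebra G \<Longrightarrow> (\<lambda>x. f x * g x) \<in> diff_algebra G"

lemma smooth_diff_algebra:
  assumes G: "\<And>g. g \<in> G \<Longrightarrow> \<exists>g'\<in>diff_algebra G. \<forall>x. (g has_vector_derivative g' x) (at x)"
    and f: "f \<in> diff_algebra G"
  shows "smooth f"
  using f
proof (rule smooth_coinduct)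
  show "\<exists>g'\<in>diff_algebra G. \<forall>x. (g has_vector_derivative g' x) (at x)"
    if "g \<in> diff_algebra G" for g
    using that
  proof induction
    case (const c)
    show ?case by (intro bexI[OF _ diff_algebra.const[of 0]] allI) simp
  next
    case (add f g)
    then obtain f' g' where "f' \<in> diff_algebra G" "g' \<in> diff_algebra G"
      "\<And>x. (f has_vector_derivative f' x) (at x)" "\<And>x. (g has_vector_derivative g' x) (at x)"
      by blast
    then show ?case
      by (intro bexI[of _ "\<lambda>x. f' x + g' x"] allI has_vector_derivative_add diff_algebra.add)
  next
    case (mult f g)
    then obtain f' g' where "f' \<in> diff_algebra G" "g' \<in> diff_algebra G"
      "\<And>x. (f has_vector_derivative f' x) (at x)" "\<And>x. (g has_vector_derivative g' x) (at x)"
      by blast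
    then show ?case
      using mult.hyps
      by (intro bexI[of _ "\<lambda>x. f x * g' x + f' x * g x"] allI
          has_vector_derivative_mult diff_algebra.add diff_algebra.mult)
  qed (rule G)
qed

lemma smooth_algebra:
  assumes "f \<in> diff_algebra {f. smooth f}"
  shows "smooth f"
  using _ assms
proof (rule smooth_diff_algebra)
  show "\<exists>g'\<in>diff_algebra {f. smooth f}. \<forall>x. (g has_vector_derivative g' x) (at x)"
    if "g \<in> {f. smooth f}" for g
    using smooth_has_derivative[of g] that by (auto intro: diff_algebra.gen)
qed

lemma smooth_const: "smooth (\<lambda>x. c)"
  by (rule smooth_algebra) (rule diff_algebra.const)

lemma smooth_add: "smooth f \<Longrightarrow> smooth g \<Longrightarrow> smooth (\<lambda>x. f x + g x)"
  by (rule smooth_algebra) (simp add: diff_algebra.add diff_algebra.gen)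

lemma smooth_mult: "smooth f \<Longrightarrow> smooth g \<Longrightarrow> smooth (\<lambda>x. f x * g x)"
  by (rule smooth_algebra) (simp add: diff_algebra.mult diff_algebra.gen)

lemma smooth_affine:
  assumes "smooth f"
  shows "smooth (\<lambda>x. f (a * x + b))"
proof (rule smooth_coinduct)
  let ?S = "{(\<lambda>x. c * f (a * x + b)) |c f. smooth f}"
  have "(\<lambda>x. f (a * x + b)) = (\<lambda>x. 1 * f (a * x + b))" by simp
  then show "(\<lambda>x. f (a * x + b)) \<in> ?S" using assms by blast
  fix g assume "g \<in> ?S"
  then obtain c f where g: "g = (\<lambda>x. c * f (a * x + b))" "smooth f" by auto
  from smooth_has_derivative[OF g(2)] obtain f'
    where f': "smooth f'" "\<And>x. (f has_vector_derivative f' x) (at x)" by blast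
  have "(g has_vector_derivative (c * of_real a) * f' (a * x + b)) (at x)" for x
  proof -
    have "((\<lambda>x. a * x + b) has_vector_derivative a) (at x)"
      by (auto intro!: derivative_eq_intros)
    from vector_diff_chain_at[OF this f'(2)]
    have "((\<lambda>x. f (a * x + b)) has_vector_derivative a *\<^sub>R f' (a * x + b)) (at x)"
      by (simp add: o_def)
    from has_vector_derivative_mult_right[OF this, of c]
    show ?thesis by (simp add: g scaleR_conv_of_real mult.assoc)
  qed
  then show "\<exists>g'\<in>?S. \<forall>x. (g has_vector_derivative g' x) (at x)"
    using f'(1) by (intro bexI[of _ "\<lambda>x. (c * of_real a) * f' (a * x + b)"]) blast+
qed

lemma smooth_imp_continuous: "smooth f \<Longrightarrow> continuous_on UNIV f"
  using smooth_has_derivative[of f]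
  by (meson continuous_at_imp_continuous_on has_vector_derivative_continuous)

text \<open>
  The classical function \<open>exp (-1/x)\<close>, extended by zero to the left half-line, is
  \<open>flat 0\<close>. The extra powers of \<open>1/x\<close> make the family stable under differentiation
  up to linear combinations.
\<close>

definition flat :: "nat \<Rightarrow> real \<Rightarrow> complex" where
  "flat n x = (if 0 < x then of_real (inverse x ^ n * exp (- inverse x)) else 0)"

lemma flat_tendsto_0: "(flat n \<longlongrightarrow> 0) (at 0)"
proof -
  have "((\<lambda>y::real. y ^ n / exp y) \<longlongrightarrow> 0) at_top" by (rule tendsto_power_div_exp_0)
  then have "((\<lambda>x::real. inverse x ^ n / exp (inverse x)) \<longlongrightarrow> 0) (at_right 0)"
    by (rule filterlim_compose[OF _ filterlim_inverse_at_top_right])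
  then have "((\<lambda>x. of_real (inverse x ^ n / exp (inverse x)) :: complex) \<longlongrightarrow> of_real 0) (at_right 0)"
    by (rule tendsto_of_real)
  then have "(flat n \<longlongrightarrow> 0) (at_right 0)"
    unfolding of_real_0
    by (rule Lim_transform_eventually)
      (auto simp: flat_def eventually_at_filter exp_minus divide_inverse)
  moreover have "(flat n \<longlongrightarrow> 0) (at_left 0)"
    by (rule Lim_transform_eventually[OF tendsto_const])
      (auto simp: flat_def eventually_at_filter)
  ultimately show ?thesis by (simp add: filterlim_at_split)
qed

lemma flat_has_derivative:
  "(flat n has_vector_derivative (- of_nat n * flat (Suc n) x + flat (Suc (Suc n)) x)) (at x)"
proof -
  consider "x > 0" | "x < 0" | "x = 0" by linarith
  then show ?thesis
  proof cases
    case 1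
    have eq: "real n * (inverse x ^ (n - 1) * - (inverse x)\<^sup>2) = - real n * inverse x ^ Suc n"
      by (cases n) (simp_all add: power2_eq_square algebra_simps)
    have "((\<lambda>x. inverse x) has_real_derivative - (inverse x)\<^sup>2) (at x)"
      using 1 by (auto intro!: derivative_eq_intros simp: power2_eq_square)
    then have "((\<lambda>x. inverse x ^ n * exp (- inverse x)) has_real_derivative
        (- real n * inverse x ^ Suc n) * exp (- inverse x) + inverse x ^ n * (exp (- inverse x) * (inverse x)\<^sup>2)) (at x)"
      unfolding eq[symmetric] using 1
      by (auto intro!: derivative_eq_intros simp: power2_eq_square algebra_simps)
    then have "((\<lambda>x. inverse x ^ n * exp (- inverse x)) has_real_derivative
        (- real n * (inverse x ^ Suc n * exp (- inverse x)) + inverse x ^ Suc (Suc n) * exp (- inverse x))) (at x)"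
      by (simp add: power2_eq_square algebra_simps)
    from has_vector_derivative_of_real[OF this]
    show ?thesis
      by (rule has_vector_derivative_transform_within_open[where S = "{0<..}", THEN back_subst[of "\<lambda>d. (flat n has_vector_derivative d) (at x)"]])
        (use 1 in \<open>auto simp: flat_def\<close>)
  next
    case 2
    have "((\<lambda>x. 0) has_vector_derivative (0::complex)) (at x)" by simp
    then have "(flat n has_vector_derivative 0) (at x)"
      by (rule has_vector_derivative_transform_within_open[where S = "{..<0}"])
        (use 2 in \<open>auto simp: flat_def\<close>)
    with 2 show ?thesis by (simp add: flat_def)
  next
    case 3
    \<comment> \<open>The difference quotient of \<open>flat n\<close> at \<open>0\<close> is \<open>flat (Suc n)\<close>.\<close>
    have "(\<lambda>h. norm (flat n h) / norm h) = (\<lambda>h. norm (flat (Suc n) h))"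
      by (auto simp: flat_def fun_eq_iff norm_mult norm_divide norm_power field_simps)
    then have "((\<lambda>h. norm (flat n h) / norm h) \<longlongrightarrow> 0) (at 0)"
      using flat_tendsto_0[of "Suc n"] by (simp add: tendsto_norm_zero)
    then have "(flat n has_vector_derivative 0) (at 0)"
      unfolding has_vector_derivative_def has_derivative_at by (simp add: flat_def)
    with 3 show ?thesis by (simp add: flat_def)
  qed
qed

lemma smooth_flat: "smooth (flat n)"
proof (rule smooth_diff_algebra)
  show "flat n \<in> diff_algebra (range flat)" by (intro diff_algebra.gen) simp
  fix g assume "g \<in> range flat"
  then obtain m where m: "g = flat m" by auto
  show "\<exists>g'\<in>diff_algebra (range flat). \<forall>x. (g has_vector_derivative g' x) (at x)"
    unfolding m
    by (intro bexI[of _ "\<lambda>x. - of_nat m * flat (Suc m) x + flat (Suc (Suc m)) x"] allI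
        flat_has_derivative diff_algebra.add diff_algebra.mult diff_algebra.const diff_algebra.gen) auto
qed

section \<open>Density of the test functions\<close>

lemma closure_limit:
  fixes x :: "'a::metric_space"
  assumes "s \<longlonglongrightarrow> x" "\<And>n. s n \<in> closure S"
  shows "x \<in> closure S"
  by (rule closed_sequentially[OF closed_closure assms(2,1)])

lemma abs_l2_add:
  "square_integrable f \<Longrightarrow> square_integrable g \<Longrightarrow> abs_l2 (\<lambda>x. f x + g x) = abs_l2 f + abs_l2 g"
  by (simp add: plus_l2.abs_eq l2rel_self_iff)

lemma abs_l2_scaleC: "square_integrable f \<Longrightarrow> abs_l2 (\<lambda>x. c * f x) = c *\<^sub>C abs_l2 f"
  by (simp add: scaleC_l2.abs_eq l2rel_self_iff)

lemma abs_l2_eq_iff: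
  assumes "square_integrable f" "square_integrable g"
  shows "abs_l2 f = abs_l2 g \<longleftrightarrow> (AE x in lborel. f x = g x)"
  using Quotient3_rel[OF Quotient3_l2, of f g] assms by (simp add: l2rel_def)

text \<open>
  Dominated convergence, applied to the squared distance with majorant \<open>4 |w|\<^sup>2\<close>.
\<close>

lemma abs_l2_tendsto:
  assumes s: "\<And>n. square_integrable (s n)" and f: "square_integrable f"
    and w: "square_integrable w"
    and le: "\<And>n x. cmod (s n x) \<le> cmod (w x)" and lim: "\<And>x. (\<lambda>n. s n x) \<longlonglongrightarrow> f x"
  shows "(\<lambda>n. abs_l2 (s n)) \<longlonglongrightarrow> abs_l2 f"
proof -
  have [measurable]: "s n \<in> borel_measurable lborel" "f \<in> borel_measurable lborel" for n
    using s f by (auto simp: square_integrable_def)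
  have fw: "cmod (f x) \<le> cmod (w x)" for x
    using le by (intro tendsto_upperbound[OF tendsto_norm[OF lim]]) auto
  have "(\<lambda>n. LINT x|lborel. (cmod (s n x - f x))\<^sup>2) \<longlonglongrightarrow> (LINT x|(lborel :: real measure). 0)"
  proof (rule integral_dominated_convergence)
    show "integrable lborel (\<lambda>x. 4 * (cmod (w x))\<^sup>2)"
      using w by (simp add: square_integrable_def)
    show "AE x in lborel. (\<lambda>n. (cmod (s n x - f x))\<^sup>2) \<longlonglongrightarrow> 0"
    proof (intro AE_I2)
      fix x
      have "(\<lambda>n. (cmod (s n x - f x))\<^sup>2) \<longlonglongrightarrow> (cmod (f x - f x))\<^sup>2"
        by (intro tendsto_intros lim)
      then show "(\<lambda>n. (cmod (s n x - f x))\<^sup>2) \<longlonglongrightarrow> 0" by simp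
    qed
    show "AE x in lborel. norm ((cmod (s n x - f x))\<^sup>2) \<le> 4 * (cmod (w x))\<^sup>2" for n
    proof (intro AE_I2)
      fix x
      have "cmod (s n x - f x) \<le> 2 * cmod (w x)"
        using norm_triangle_ineq4[of "s n x" "f x"] le[of n x] fw[of x] by linarith
      then have "(cmod (s n x - f x))\<^sup>2 \<le> (2 * cmod (w x))\<^sup>2" by (intro power_mono) auto
      then show "norm ((cmod (s n x - f x))\<^sup>2) \<le> 4 * (cmod (w x))\<^sup>2"
        by (simp add: power_mult_distrib)
    qed
  qed measurable
  moreover have "(LINT x|lborel. (cmod (s n x - f x))\<^sup>2) = (norm (abs_l2 (s n) - abs_l2 f))\<^sup>2" for n
    using s f by (simp add: abs_l2_diff norm_abs_l2 square_integrable_diff)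
  ultimately have "(\<lambda>n. sqrt ((norm (abs_l2 (s n) - abs_l2 f))\<^sup>2)) \<longlonglongrightarrow> sqrt 0"
    by (intro tendsto_real_sqrt) simp
  then have "(\<lambda>n. norm (abs_l2 (s n) - abs_l2 f)) \<longlonglongrightarrow> 0" by simp
  then show ?thesis by (rule LIM_zero_cancel[OF tendsto_norm_zero_cancel])
qed

lemma continuous_compact_support:
  fixes f :: "real \<Rightarrow> complex"
  assumes "continuous_on UNIV f" "bounded {x. f x \<noteq> 0}"
  obtains K R where "\<And>x. cmod (f x) \<le> K * indicator {-R..R} x" "K \<ge> 0" "R \<ge> 0"
    "\<And>x. \<bar>x\<bar> > R \<Longrightarrow> f x = 0"
proof -
  obtain R where R: "R > 0" "\<And>x. f x \<noteq> 0 \<Longrightarrow> \<bar>x\<bar> \<le> R"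
    using assms(2) unfolding bounded_pos by (auto simp: real_norm_def)
  have "bounded (f ` {-R..R})"
    by (intro compact_imp_bounded compact_continuous_image continuous_on_subset[OF assms(1)]) auto
  then obtain K where K: "K > 0" "\<And>x. x \<in> {-R..R} \<Longrightarrow> cmod (f x) \<le> K"
    unfolding bounded_pos by auto
  have zero: "f x = 0" if "\<bar>x\<bar> > R" for x using R(2)[of x] that by auto
  have "cmod (f x) \<le> K * indicator {-R..R} x" for x
    using K(2)[of x] zero[of x] by (auto simp: indicator_def abs_le_iff)
  with zero K R that[of K R] show thesis by force
qed

lemma
  fixes f :: "real \<Rightarrow> complex"
  assumes "continuous_on UNIV f" "bounded {x. f x \<noteq> 0}"
  shows continuous_compact_support_integrable: "integrable lborel f"
    and continuous_compact_support_square_integrable: "square_integrable f"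
proof -
  obtain K R where K: "\<And>x. cmod (f x) \<le> K * indicator {-R..R} x" "K \<ge> 0"
    using continuous_compact_support[OF assms] by metis
  have [measurable]: "f \<in> borel_measurable lborel"
    using borel_measurable_continuous_onI[OF assms(1)] by simp
  have ind: "integrable lborel (\<lambda>x. c * indicator {-R..R} x :: real)" for c
    by (intro integrable_mult_right integrable_real_indicator) (auto simp: emeasure_lborel_Icc_eq)
  show "integrable lborel f"
    by (rule Bochner_Integration.integrable_bound[OF ind[of K]]) (use K in \<open>auto simp: abs_mult\<close>)
  have sq: "(cmod (f x))\<^sup>2 \<le> K\<^sup>2 * indicator {-R..R} x" for x
    using power_mono[OF K(1)[of x], of 2] by (auto simp: indicator_def)
  have "integrable lborel (\<lambda>x. (cmod (f x))\<^sup>2)"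
    by (rule Bochner_Integration.integrable_bound[OF ind[of "K\<^sup>2"]])
      (use sq in \<open>auto simp: abs_mult\<close>)
  then show "square_integrable f" by (simp add: square_integrable_def)
qed

definition test_function :: "(real \<Rightarrow> complex) \<Rightarrow> bool" where
  "test_function \<phi> \<longleftrightarrow> smooth \<phi> \<and> bounded {x. \<phi> x \<noteq> 0}"

lemma test_functions_eq: "test_functions = abs_l2 ` {\<phi>. test_function \<phi>}"
  by (auto simp: test_functions_def test_function_def compact_closure)

lemma
  assumes "test_function \<phi>"
  shows test_function_continuous: "continuous_on UNIV \<phi>"
    and test_function_bounded_support: "bounded {x. \<phi> x \<noteq> 0}"
    and test_function_square_integrable: "square_integrable \<phi>"
    and test_function_integrable: "integrable lborel \<phi>"
proof -
  note \<phi> = assms[unfolded test_function_def]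
  show c: "continuous_on UNIV \<phi>" by (rule smooth_imp_continuous[OF conjunct1[OF \<phi>]])
  show b: "bounded {x. \<phi> x \<noteq> 0}" by (rule conjunct2[OF \<phi>])
  show "square_integrable \<phi>" by (rule continuous_compact_support_square_integrable[OF c b])
  show "integrable lborel \<phi>" by (rule continuous_compact_support_integrable[OF c b])
qed

lemma test_function_zero: "test_function (\<lambda>x. 0)"
  by (simp add: test_function_def smooth_const)

lemma test_function_add:
  assumes "test_function \<phi>" "test_function \<psi>"
  shows "test_function (\<lambda>x. \<phi> x + \<psi> x)"
proof -
  have "bounded {x. \<phi> x + \<psi> x \<noteq> 0}"
    by (rule bounded_subset[of "{x. \<phi> x \<noteq> 0} \<union> {x. \<psi> x \<noteq> 0}"])
      (use assms in \<open>auto simp: test_function_def\<close>)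
  with assms show ?thesis by (simp add: test_function_def smooth_add)
qed

lemma test_function_cmult:
  assumes "test_function \<phi>"
  shows "test_function (\<lambda>x. c * \<phi> x)"
proof -
  have "bounded {x. c * \<phi> x \<noteq> 0}"
    by (rule bounded_subset[of "{x. \<phi> x \<noteq> 0}"]) (use assms in \<open>auto simp: test_function_def\<close>)
  with assms show ?thesis by (simp add: test_function_def smooth_mult smooth_const)
qed

lemma test_functions_zero: "0 \<in> test_functions"
  unfolding test_functions_eq zero_l2_def by (simp add: test_function_zero)

lemma test_functions_add:
  assumes "f \<in> test_functions" "g \<in> test_functions"
  shows "f + g \<in> test_functions"
proof -
  obtain \<phi> \<psi> where "test_function \<phi>" "f = abs_l2 \<phi>" "test_function \<psi>" "g = abs_l2 \<psi>"
    using assms unfolding test_functions_eq by blast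
  then have "f + g = abs_l2 (\<lambda>x. \<phi> x + \<psi> x)" "test_function (\<lambda>x. \<phi> x + \<psi> x)"
    by (simp_all add: abs_l2_add test_function_add test_function_square_integrable)
  then show ?thesis unfolding test_functions_eq by blast
qed

lemma test_functions_scaleC:
  assumes "f \<in> test_functions"
  shows "c *\<^sub>C f \<in> test_functions"
proof -
  obtain \<phi> where "test_function \<phi>" "f = abs_l2 \<phi>"
    using assms unfolding test_functions_eq by blast
  then have "c *\<^sub>C f = abs_l2 (\<lambda>x. c * \<phi> x)" "test_function (\<lambda>x. c * \<phi> x)"
    by (simp_all add: abs_l2_scaleC test_function_cmult test_function_square_integrable)
  then show ?thesis unfolding test_functions_eq by blast
qed

lemma closure_test_functions_zero: "abs_l2 (\<lambda>x. 0) \<in> closure test_functions"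
  using test_functions_zero closure_subset by (auto simp: zero_l2_def)

lemma closure_test_functions_add:
  assumes "f \<in> closure test_functions" "g \<in> closure test_functions"
  shows "f + g \<in> closure test_functions"
proof -
  obtain s r where "\<And>n. s n \<in> test_functions" "s \<longlonglongrightarrow> f" "\<And>n. r n \<in> test_functions" "r \<longlonglongrightarrow> g"
    using assms unfolding closure_sequential by metis
  then show ?thesis
    unfolding closure_sequential
    by (intro exI[of _ "\<lambda>n. s n + r n"]) (auto intro: test_functions_add tendsto_add)
qed

lemma closure_test_functions_scaleC:
  assumes "f \<in> closure test_functions"
  shows "c *\<^sub>C f \<in> closure test_functions"
proof -
  obtain s where "\<And>n. s n \<in> test_functions" "s \<longlonglongrightarrow> f"
    using assms unfolding closure_sequential by metis
  then show ?thesis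
    unfolding closure_sequential
    by (intro exI[of _ "\<lambda>n. c *\<^sub>C s n"]) (auto intro: test_functions_scaleC tendsto_scaleC)
qed

abbreviation ind :: "real set \<Rightarrow> real \<Rightarrow> complex" where
  "ind A \<equiv> indicator A"

lemma square_integrable_indicator:
  assumes "A \<in> sets borel" "bounded A"
  shows "square_integrable (ind A)"
proof -
  have "emeasure lborel A < \<infinity>"
    using emeasure_bounded_finite[OF assms(2)] by simp
  then have "integrable lborel (indicator A :: real \<Rightarrow> real)"
    using assms(1) by (intro integrable_real_indicator) (auto simp: emeasure_lborel_Icc_eq)
  moreover have "(cmod (ind A x))\<^sup>2 = indicator A x" for x
    by (simp add: indicator_def)
  ultimately show ?thesis
    using assms(1) by (simp add: square_integrable_def)
qed

text \<open>
  The smooth functions \<open>exp (-1/(n (x - a))) exp (-1/(n (b - x)))\<close>, supported in the interval, increase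
  to its indicator function as \<open>n\<close> grows.
\<close>

lemma interval_in_closure_test_functions:
  "abs_l2 (ind {a<..<b}) \<in> closure test_functions"
proof -
  \<comment> \<open>The arguments are written in affine form so that \<open>smooth_affine\<close> applies;
    \<open>Suc n\<close> keeps the scaling factor positive.\<close>
  define \<psi> where "\<psi> n x = flat 0 (real (Suc n) * x + - real (Suc n) * a) *
      flat 0 (- real (Suc n) * x + real (Suc n) * b)" for n x
  have flat_le: "cmod (flat 0 x) \<le> 1" for x by (auto simp: flat_def)
  have lim1: "(\<lambda>n. flat 0 (real (Suc n) * y)) \<longlonglongrightarrow> 1" if "y > 0" for y
  proof -
    have "(\<lambda>n. exp (- (inverse (real (Suc n)) * inverse y))) \<longlonglongrightarrow> exp (- (0 * inverse y))"
      by (intro tendsto_intros LIMSEQ_inverse_real_of_nat)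
    then have "(\<lambda>n. complex_of_real (exp (- (inverse (real (Suc n)) * inverse y)))) \<longlonglongrightarrow> of_real (exp (- (0 * inverse y)))"
      by (rule tendsto_of_real)
    then show ?thesis using that by (simp add: flat_def)
  qed
  have eq: "\<psi> n x = flat 0 (real (Suc n) * (x - a)) * flat 0 (real (Suc n) * (b - x))" for n x
    unfolding \<psi>_def by (simp add: algebra_simps)
  have zero: "\<psi> n x = 0" if "x \<notin> {a<..<b}" for n x
    using that unfolding eq by (auto simp: flat_def zero_less_mult_iff)
  have test: "test_function (\<psi> n)" for n
    unfolding test_function_def
  proof
    show "smooth (\<psi> n)" unfolding \<psi>_def by (intro smooth_mult smooth_affine smooth_flat)
    have "{x. \<psi> n x \<noteq> 0} \<subseteq> {a<..<b}" using zero by blast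
    then show "bounded {x. \<psi> n x \<noteq> 0}" by (rule bounded_subset[rotated]) simp
  qed
  have "(\<lambda>n. abs_l2 (\<psi> n)) \<longlonglongrightarrow> abs_l2 (ind {a<..<b})"
  proof (rule abs_l2_tendsto)
    show "cmod (\<psi> n x) \<le> cmod (ind {a<..<b} x)" for n x
      using zero[of x n] mult_mono[OF flat_le flat_le]
      by (cases "x \<in> {a<..<b}") (auto simp: eq norm_mult)
    show "(\<lambda>n. \<psi> n x) \<longlonglongrightarrow> ind {a<..<b} x" for x
    proof (cases "x \<in> {a<..<b}")
      case True
      then have "(\<lambda>n. \<psi> n x) \<longlonglongrightarrow> 1 * 1"
        unfolding eq by (intro tendsto_mult lim1) auto
      with True show ?thesis by simp
    qed (simp add: zero)
  qed (auto intro: test test_function_square_integrable square_integrable_indicator)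
  then show ?thesis
    by (rule closure_limit)
      (use test closure_subset[of test_functions] in \<open>auto simp: test_functions_eq\<close>)
qed

text \<open>
  The sets \<open>B\<close> with this property form a Dynkin system containing the intersection-stable
  family of open intervals. Cutting down to a bounded window keeps all indicator functions
  square-integrable and provides the majorant for countable unions.
\<close>

lemma borel_set_in_closure_test_functions:
  assumes "B \<in> sets borel"
  shows "abs_l2 (ind (B \<inter> {-r<..<r})) \<in> closure test_functions"
proof -
  let ?J = "{-r<..<r}" and ?V = "closure test_functions"
  let ?G = "range (\<lambda>(a, b). {a<..<b::real})"
  have borel_G: "sets borel = sigma_sets UNIV ?G"
    by (simp add: borel_eq_box box_real)
  have sq: "square_integrable (ind (A \<inter> ?J))" if "A \<in> sets borel" for A
    using that by (intro square_integrable_indicator) (use bounded_Int in auto)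
  have "Int_stable ?G"
  proof (rule Int_stableI, safe)
    fix a b c d :: real
    have "{a<..<b} \<inter> {c<..<d} = {max a c<..<min b d}" by auto
    then show "{a<..<b} \<inter> {c<..<d} \<in> ?G" by auto
  qed
  moreover have "?G \<subseteq> Pow UNIV" by simp
  moreover have "B \<in> sigma_sets UNIV ?G" using assms borel_G by simp
  ultimately show ?thesis
  proof (induction rule: sigma_sets_induct_disjoint)
    case (basic A)
    then obtain a b where "A = {a<..<b}" by auto
    then have "A \<inter> ?J = {max a (-r)<..<min b r}" by auto
    then show ?case by (simp only: interval_in_closure_test_functions)
  next
    case empty
    show ?case by (simp add: closure_test_functions_zero)
  next
    case (compl A)
    have A: "A \<in> sets borel" using compl.hyps borel_G by simp
    have "ind ((UNIV - A) \<inter> ?J) = (\<lambda>x. ind ?J x + (-1) * ind (A \<inter> ?J) x)"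
      by (auto simp: indicator_def fun_eq_iff)
    moreover have "abs_l2 \<dots> = abs_l2 (ind ?J) + (-1) *\<^sub>C abs_l2 (ind (A \<inter> ?J))"
      using sq[OF A] sq[of UNIV, simplified]
      by (simp only: abs_l2_add abs_l2_scaleC square_integrable_mult)
    ultimately show ?case
      using compl.IH interval_in_closure_test_functions
      by (simp only: closure_test_functions_add closure_test_functions_scaleC)
  next
    case (union A)
    have A: "A i \<in> sets borel" for i using union.hyps(2) borel_G by blast
    have fin: "abs_l2 (ind ((\<Union>i<n. A i) \<inter> ?J)) \<in> ?V" for n
    proof (induction n)
      case 0
      show ?case by (simp add: closure_test_functions_zero)
    next
      case (Suc n)
      have "x \<notin> A n" if "x \<in> A i" "i < n" for x i
        using disjoint_family_onD[OF union.hyps(1), of i n] that by auto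
      then have "ind ((\<Union>i<Suc n. A i) \<inter> ?J) = (\<lambda>x. ind ((\<Union>i<n. A i) \<inter> ?J) x + ind (A n \<inter> ?J) x)"
        by (auto simp: indicator_def fun_eq_iff less_Suc_eq)
      moreover have "abs_l2 \<dots> = abs_l2 (ind ((\<Union>i<n. A i) \<inter> ?J)) + abs_l2 (ind (A n \<inter> ?J))"
        by (intro abs_l2_add sq) (use A in auto)
      ultimately show ?case using Suc union.IH by (simp only: closure_test_functions_add)
    qed
    have "(\<lambda>n. abs_l2 (ind ((\<Union>i<n. A i) \<inter> ?J))) \<longlonglongrightarrow> abs_l2 (ind ((\<Union>i. A i) \<inter> ?J))"
    proof (rule abs_l2_tendsto)
      show "cmod (ind ((\<Union>i<n. A i) \<inter> ?J) x) \<le> cmod (ind ?J x)" for n x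
        by (auto simp: indicator_def)
      show "(\<lambda>n. ind ((\<Union>i<n. A i) \<inter> ?J) x) \<longlonglongrightarrow> ind ((\<Union>i. A i) \<inter> ?J) x" for x
      proof -
        have "(\<lambda>n. ind (\<Union>i<n. A i) x * ind ?J x) \<longlonglongrightarrow> ind (\<Union>i. A i) x * ind ?J x"
          by (intro tendsto_mult tendsto_const LIMSEQ_indicator_UN)
        then show ?thesis by (simp add: indicator_inter_arith)
      qed
    qed (use A in \<open>auto intro!: sq square_integrable_indicator\<close>)
    then show ?case by (rule closure_limit[OF _ fin])
  qed
qed

text \<open>
  A square-integrable function is the dominated limit of simple functions, each of which
  may be cut off to a bounded window and is then a finite combination of indicators of
  bounded Borel sets.
\<close>

lemma closure_test_functions: "closure test_functions = UNIV"
proof (intro equalityI subset_UNIV subsetI)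
  fix g :: l2
  define f where "f = rep_l2 g"
  have f: "square_integrable f" and g: "g = abs_l2 f"
    by (simp_all add: f_def square_integrable_rep_l2 abs_rep_l2)
  have fm: "f \<in> borel_measurable lborel" using f by (simp add: square_integrable_def)
  obtain s where s: "\<And>i. simple_function lborel (s i)"
    "\<And>x. (\<lambda>i. s i x) \<longlonglongrightarrow> f x" "\<And>i x. cmod (s i x) \<le> 2 * cmod (f x)"
    using borel_measurable_implies_sequence_metric[OF fm, of 0]
    by (auto simp: space_lborel)
  let ?J = "\<lambda>i. {- real i<..<real i}"
  define F where "F i x = (\<Sum>c\<in>range (s i). c * ind (s i -` {c} \<inter> ?J i) x)" for i x
  have fin: "finite (range (s i))" for i
    using simple_functionD(1)[OF s(1)[of i]] by simp
  have vim: "s i -` {c} \<in> sets borel" for i c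
    using simple_functionD(2)[OF s(1)[of i], of "{c}"] by simp
  have sq: "square_integrable (ind (s i -` {c} \<inter> ?J i))" for i c
    using vim by (intro square_integrable_indicator) (use bounded_Int in auto)
  have F_eq: "F i x = s i x * ind (?J i) x" for i x
  proof -
    have "F i x = (\<Sum>c\<in>range (s i). if s i x = c then c * ind (?J i) x else 0)"
      unfolding F_def by (intro sum.cong) (auto simp: indicator_def)
    also have "\<dots> = s i x * ind (?J i) x" using fin by (subst sum.delta') auto
    finally show ?thesis .
  qed
  define p where "p i c x = c * ind (s i -` {c} \<inter> ?J i) x" for i c x
  have p: "square_integrable (p i c)" "abs_l2 (p i c) \<in> closure test_functions" for i c
    using borel_set_in_closure_test_functions[OF vim[of i c], of "real i"]
    unfolding p_def[abs_def]
    by (simp_all only: abs_l2_scaleC square_integrable_mult sq closure_test_functions_scaleC)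
  have "square_integrable (\<lambda>x. \<Sum>c\<in>C. p i c x) \<and>
      abs_l2 (\<lambda>x. \<Sum>c\<in>C. p i c x) \<in> closure test_functions" if "finite C" for C i
    using that
    by induction (simp_all add: square_integrable_zero closure_test_functions_zero
        abs_l2_add square_integrable_add closure_test_functions_add p)
  from this[OF fin] have F: "square_integrable (F i)" "abs_l2 (F i) \<in> closure test_functions" for i
    unfolding F_def[abs_def] p_def by auto
  have "(\<lambda>i. abs_l2 (F i)) \<longlonglongrightarrow> abs_l2 f"
  proof (rule abs_l2_tendsto)
    show "square_integrable (\<lambda>x. 2 * f x)" by (rule square_integrable_mult[OF f])
    show "cmod (F i x) \<le> cmod (2 * f x)" for i x
      using s(3)[of i x] by (auto simp: F_eq indicator_def norm_mult)
    show "(\<lambda>i. F i x) \<longlonglongrightarrow> f x" for x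
    proof (rule Lim_transform_eventually[OF s(2)])
      obtain N where "\<bar>x\<bar> < real N" using reals_Archimedean2 by blast
      then show "\<forall>\<^sub>F i in sequentially. s i x = F i x"
        unfolding F_eq by (intro eventually_sequentiallyI[of N]) (auto simp: indicator_def)
    qed
  qed (use F f in auto)
  then show "g \<in> closure test_functions"
    unfolding g by (rule closure_limit[OF _ F(2)])
qed

section \<open>Plancherel's theorem\<close>

lemma integrable_product:
  fixes f :: "'a \<Rightarrow> real" and g :: "'b \<Rightarrow> real"
  assumes "sigma_finite_measure M" "sigma_finite_measure N"
    and f: "integrable M f" and g: "integrable N g"
  shows "integrable (M \<Otimes>\<^sub>M N) (\<lambda>(x, y). f x * g y)"
proof -
  interpret M: sigma_finite_measure M by fact
  interpret N: sigma_finite_measure N by fact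
  interpret pair_sigma_finite M N ..
  have [measurable]: "f \<in> borel_measurable M" "g \<in> borel_measurable N" using f g by auto
  show ?thesis
  proof (rule Fubini_integrable)
    show "(\<lambda>(x, y). f x * g y) \<in> borel_measurable (M \<Otimes>\<^sub>M N)" by measurable
    show "integrable M (\<lambda>x. \<integral>y. norm (case (x, y) of (x, y) \<Rightarrow> f x * g y) \<partial>N)"
      using f by (simp add: abs_mult)
    show "AE x in M. integrable N (\<lambda>y. case (x, y) of (x, y) \<Rightarrow> f x * g y)"
      using g by simp
  qed
qed

text \<open>
  Fubini's theorem with a product majorant, the form in which it is used for the
  oscillatory integrals below.
\<close>

lemma integral_swap_dominated:
  fixes f :: "'a \<Rightarrow> 'b \<Rightarrow> complex"
  assumes "sigma_finite_measure M" "sigma_finite_measure N"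
    and [measurable]: "(\<lambda>(x, y). f x y) \<in> borel_measurable (M \<Otimes>\<^sub>M N)"
    and u: "integrable M u" and v: "integrable N v"
    and le: "\<And>x y. cmod (f x y) \<le> u x * v y"
  shows "(\<integral>y. \<integral>x. f x y \<partial>M \<partial>N) = (\<integral>x. \<integral>y. f x y \<partial>N \<partial>M)"
proof -
  interpret M: sigma_finite_measure M by fact
  interpret N: sigma_finite_measure N by fact
  interpret pair_sigma_finite M N ..
  have "integrable (M \<Otimes>\<^sub>M N) (\<lambda>(x, y). f x y)"
  proof (rule Bochner_Integration.integrable_bound)
    show "integrable (M \<Otimes>\<^sub>M N) (\<lambda>(x, y). u x * v y)"
      by (rule integrable_product) fact+
    show "AE p in M \<Otimes>\<^sub>M N. norm (case p of (x, y) \<Rightarrow> f x y) \<le> norm (case p of (x, y) \<Rightarrow> u x * v y)"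
      by (intro AE_I2) (auto intro: order_trans[OF le])
  qed measurable
  then show ?thesis by (rule Fubini_integral)
qed

lemma borel_measurable_cis [measurable]: "cis \<in> borel_measurable borel"
  by (intro borel_measurable_continuous_onI continuous_on_cis continuous_on_id)

lemma borel_measurable_cnj [measurable]: "cnj \<in> borel_measurable borel"
  by (intro borel_measurable_continuous_onI continuous_on_cnj continuous_on_id)

text \<open>
  The explicit bounds provide the integrable majorants of all integrals over \<open>\<phi>\<close>.
\<close>

locale continuous_compactly_supported =
  fixes \<phi> :: "real \<Rightarrow> complex" and K R :: real
  assumes cont: "continuous_on UNIV \<phi>"
    and bound: "\<And>x. cmod (\<phi> x) \<le> K * indicator {-R..R} x"
    and K_nonneg: "K \<ge> 0" and R_nonneg: "R \<ge> 0"
begin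

lemma measurable_\<phi> [measurable]: "\<phi> \<in> borel_measurable borel"
  by (rule borel_measurable_continuous_onI[OF cont])

lemma integrable_cmult_indicator: "integrable lborel (\<lambda>x. c * indicator {a..b::real} x :: real)"
  by (intro integrable_mult_right integrable_real_indicator) (auto simp: emeasure_lborel_Icc_eq)

lemma cmod_le: "cmod (\<phi> x) \<le> K"
  using bound[of x] K_nonneg by (cases "x \<in> {-R..R}") auto

lemma vanishes: "x \<notin> {-R..R} \<Longrightarrow> \<phi> x = 0"
  using bound[of x] by simp

definition autocorrelation :: "real \<Rightarrow> complex" where
  "autocorrelation t = (\<integral>y. \<phi> (y + t) * cnj (\<phi> y) \<partial>lborel)"

lemma measurable_autocorrelation [measurable]: "autocorrelation \<in> borel_measurable borel"
  unfolding autocorrelation_def[abs_def] by measurable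

lemma autocorrelation_integrand_le:
  "cmod (\<phi> (y + t) * cnj (\<phi> y)) \<le> K\<^sup>2 * indicator {-R..R} y"
proof -
  have "cmod (\<phi> (y + t)) * cmod (\<phi> y) \<le> K * (K * indicator {-R..R} y)"
    by (intro mult_mono cmod_le bound K_nonneg) simp
  then show ?thesis by (simp add: norm_mult power2_eq_square mult.assoc)
qed

lemma autocorrelation_integrand_le':
  "cmod (\<phi> (y + t) * cnj (\<phi> y)) \<le> indicator {-2*R..2*R} t * (K\<^sup>2 * indicator {-R..R} y)"
proof (cases "t \<in> {-2*R..2*R}")
  case False
  then have "y + t \<notin> {-R..R} \<or> y \<notin> {-R..R}" by auto
  then have "\<phi> (y + t) = 0 \<or> \<phi> y = 0" using vanishes by blast
  then show ?thesis by (auto intro!: mult_nonneg_nonneg)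
qed (use autocorrelation_integrand_le in simp)

lemma cmod_autocorrelation_le:
  "cmod (autocorrelation t) \<le> 2 * R * K\<^sup>2 * indicator {-2*R..2*R} t"
proof -
  have int: "integrable lborel (\<lambda>y. indicator {-2*R..2*R} t * (K\<^sup>2 * indicator {-R..R} y) :: real)"
    by (intro integrable_mult_right integrable_cmult_indicator)
  have int': "integrable lborel (\<lambda>y. \<phi> (y + t) * cnj (\<phi> y))"
    by (rule Bochner_Integration.integrable_bound[OF int])
      (use autocorrelation_integrand_le' in \<open>auto simp: abs_mult\<close>)
  have "cmod (autocorrelation t) \<le> (\<integral>y. cmod (\<phi> (y + t) * cnj (\<phi> y)) \<partial>lborel)"
    unfolding autocorrelation_def by (rule integral_norm_bound)
  also have "\<dots> \<le> (\<integral>y. indicator {-2*R..2*R} t * (K\<^sup>2 * indicator {-R..R} y) \<partial>lborel)"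
    using int int' autocorrelation_integrand_le' by (intro integral_mono integrable_norm)
  also have "\<dots> = 2 * R * K\<^sup>2 * indicator {-2*R..2*R} t"
    using R_nonneg by (simp add: integral_indicator)
  finally show ?thesis .
qed

lemma autocorrelation_tendsto:
  assumes "s \<longlonglongrightarrow> 0"
  shows "(\<lambda>n. autocorrelation (s n)) \<longlonglongrightarrow> autocorrelation 0"
  unfolding autocorrelation_def
proof (rule integral_dominated_convergence)
  show "integrable lborel (\<lambda>y. K\<^sup>2 * indicator {-R..R} y :: real)"
    by (rule integrable_cmult_indicator)
  show "AE y in lborel. (\<lambda>n. \<phi> (y + s n) * cnj (\<phi> y)) \<longlonglongrightarrow> \<phi> (y + 0) * cnj (\<phi> y)"
    using assms
    by (intro AE_I2 tendsto_mult tendsto_const continuous_on_tendsto_compose[OF cont] tendsto_add) auto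
  show "AE y in lborel. norm (\<phi> (y + s n) * cnj (\<phi> y)) \<le> K\<^sup>2 * indicator {-R..R} y" for n
    by (intro AE_I2 autocorrelation_integrand_le)
qed measurable

lemma autocorrelation_0: "autocorrelation 0 = of_real (\<integral>x. (cmod (\<phi> x))\<^sup>2 \<partial>lborel)"
  by (simp add: autocorrelation_def flip: complex_norm_square del: of_real_power)

text \<open>
  The Wiener--Khinchin identity: write the squared modulus as a double integral over
  \<open>x\<close> and \<open>y\<close>, substitute \<open>x = y + t\<close> and integrate over \<open>y\<close> first.
\<close>

lemma fourier_autocorrelation:
  "(cmod (fourier_integral \<phi> \<xi>))\<^sup>2 = of_real (1 / (2 * pi)) * (\<integral>t. autocorrelation t * cis (- (t * \<xi>)) \<partial>lborel)"
proof -
  let ?I = "\<integral>x. \<phi> x * cis (- (x * \<xi>)) \<partial>lborel"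
  have shift: "(\<integral>t. \<phi> (y + t) * cnj (\<phi> y) * cis (- (t * \<xi>)) \<partial>lborel) = ?I * cnj (\<phi> y * cis (- (y * \<xi>)))" for y
  proof -
    have "?I = (\<integral>t. \<phi> (y + t) * cis (- ((y + t) * \<xi>)) \<partial>lborel)"
      using lborel_integral_real_affine[of 1 "\<lambda>x. \<phi> x * cis (- (x * \<xi>))" y] by simp
    then have "?I * cnj (\<phi> y * cis (- (y * \<xi>))) =
        (\<integral>t. \<phi> (y + t) * cis (- ((y + t) * \<xi>)) * cnj (\<phi> y * cis (- (y * \<xi>))) \<partial>lborel)"
      by simp
    also have "\<dots> = (\<integral>t. \<phi> (y + t) * cnj (\<phi> y) * cis (- (t * \<xi>)) \<partial>lborel)"
    proof (rule Bochner_Integration.integral_cong)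
      fix t
      have "cis (- ((y + t) * \<xi>)) * cis (y * \<xi>) = cis (- (t * \<xi>))"
        by (simp add: cis_mult algebra_simps)
      then show "\<phi> (y + t) * cis (- ((y + t) * \<xi>)) * cnj (\<phi> y * cis (- (y * \<xi>))) =
          \<phi> (y + t) * cnj (\<phi> y) * cis (- (t * \<xi>))"
        by (simp add: cis_cnj mult_ac)
    qed simp
    finally show ?thesis by simp
  qed
  have "(\<integral>t. autocorrelation t * cis (- (t * \<xi>)) \<partial>lborel) =
      (\<integral>t. \<integral>y. \<phi> (y + t) * cnj (\<phi> y) * cis (- (t * \<xi>)) \<partial>lborel \<partial>lborel)"
    by (simp add: autocorrelation_def)
  also have "\<dots> = (\<integral>y. \<integral>t. \<phi> (y + t) * cnj (\<phi> y) * cis (- (t * \<xi>)) \<partial>lborel \<partial>lborel)"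
  proof (rule integral_swap_dominated[symmetric, where u = "\<lambda>t. 1 * indicator {-2*R..2*R} t" and v = "\<lambda>y. K\<^sup>2 * indicator {-R..R} y"])
    show "cmod (\<phi> (y + t) * cnj (\<phi> y) * cis (- (t * \<xi>))) \<le> 1 * indicator {-2*R..2*R} t * (K\<^sup>2 * indicator {-R..R} y)" for t y
      using autocorrelation_integrand_le'[of y t] by (simp add: norm_mult)
    show "integrable lborel (\<lambda>t. 1 * indicator {-2*R..2*R} t :: real)"
      by (rule integrable_cmult_indicator)
    show "integrable lborel (\<lambda>y. K\<^sup>2 * indicator {-R..R} y :: real)"
      by (rule integrable_cmult_indicator)
  qed (auto intro: sigma_finite_lborel)
  also have "\<dots> = (\<integral>y. ?I * cnj (\<phi> y * cis (- (y * \<xi>))) \<partial>lborel)"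
    by (simp only: shift)
  also have "\<dots> = ?I * cnj ?I"
    by (simp only: integral_mult_right_zero Bochner_Integration.integral_cnj)
  also have "\<dots> = of_real ((cmod ?I)\<^sup>2)"
    by (simp only: complex_norm_square)
  finally have "(\<integral>t. autocorrelation t * cis (- (t * \<xi>)) \<partial>lborel) = of_real ((cmod ?I)\<^sup>2)" .
  moreover have "(cmod (fourier_integral \<phi> \<xi>))\<^sup>2 = 1 / (2 * pi) * (cmod ?I)\<^sup>2"
    by (simp add: fourier_integral_def norm_mult power_mult_distrib norm_divide power_divide)
  ultimately show ?thesis by simp
qed

lemma measurable_fourier_integral [measurable]: "fourier_integral \<phi> \<in> borel_measurable borel"
  unfolding fourier_integral_def[abs_def] by measurable

lemma fourier_integral_bounded: "\<exists>B. \<forall>\<xi>. cmod (fourier_integral \<phi> \<xi>) \<le> B"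
proof (intro exI allI)
  fix \<xi>
  have "cmod (\<integral>x. \<phi> x * cis (- (x * \<xi>)) \<partial>lborel) \<le> (\<integral>x. cmod (\<phi> x * cis (- (x * \<xi>))) \<partial>lborel)"
    by (rule integral_norm_bound)
  also have "\<dots> = (\<integral>x. cmod (\<phi> x) \<partial>lborel)" by (simp add: norm_mult)
  finally show "cmod (fourier_integral \<phi> \<xi>) \<le> (1 / sqrt (2 * pi)) * (\<integral>x. cmod (\<phi> x) \<partial>lborel)"
    by (simp add: fourier_integral_def norm_mult norm_divide mult_left_mono divide_right_mono)
qed

text \<open>
  A Gaussian weight makes the energy of the Fourier transform integrable, so that the
  integrals may be exchanged; since a Gaussian is its own Fourier transform, the result is
  a Gaussian average of the autocorrelation at scale \<open>1/n\<close>.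
\<close>

lemma gaussian_average:
  assumes "n > 0"
  shows "(\<integral>\<xi>. (cmod (fourier_integral \<phi> \<xi>))\<^sup>2 * exp (- (\<xi> / n)\<^sup>2 / 2) \<partial>lborel) =
    (\<integral>s. autocorrelation (s / n) \<partial>std_normal_distribution)"
proof -
  let ?M = "std_normal_distribution" and ?F = "fourier_integral \<phi>"
  interpret M: real_distribution ?M by (rule real_dist_normal_dist)
  have [measurable]: "sets ?M = sets borel" by simp
  have const: "1 / (2 * pi) * (1 / n) * sqrt (2 * pi) = 1 / (sqrt (2 * pi) * n)"
    using assms real_sqrt_mult_self[of "2 * pi"] by (simp add: field_simps)
  have gauss: "exp (- s\<^sup>2 / 2) = sqrt (2 * pi) * std_normal_density s" for s
    by (simp add: std_normal_density_def)
  have "(\<integral>u. complex_of_real ((cmod (?F (n * u)))\<^sup>2) \<partial>?M) =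
      of_real (1 / (2 * pi)) * (\<integral>u. \<integral>t. autocorrelation t * cis (- (t * (n * u))) \<partial>lborel \<partial>?M)"
    by (simp only: fourier_autocorrelation integral_mult_right_zero)
  also have "(\<integral>u. \<integral>t. autocorrelation t * cis (- (t * (n * u))) \<partial>lborel \<partial>?M) =
      (\<integral>t. \<integral>u. autocorrelation t * cis (- (t * (n * u))) \<partial>?M \<partial>lborel)"
  proof (rule integral_swap_dominated[where u = "\<lambda>t. 2 * R * K\<^sup>2 * indicator {-2*R..2*R} t" and v = "\<lambda>u. 1"])
    show "cmod (autocorrelation t * cis (- (t * (n * u)))) \<le> 2 * R * K\<^sup>2 * indicator {-2*R..2*R} t * 1" for t u
      using cmod_autocorrelation_le[of t] by (simp add: norm_mult)
    show "integrable lborel (\<lambda>t. 2 * R * K\<^sup>2 * indicator {-2*R..2*R} t :: real)"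
      by (rule integrable_cmult_indicator)
  qed (auto intro: sigma_finite_lborel M.sigma_finite_measure)
  also have "\<dots> = (\<integral>t. autocorrelation t * of_real (exp (- (t * n)\<^sup>2 / 2)) \<partial>lborel)"
  proof (rule Bochner_Integration.integral_cong)
    fix t
    have "(\<integral>u. cis (- (t * (n * u))) \<partial>?M) = char ?M (- (t * n))"
      by (simp add: char_def cis_conv_exp mult_ac)
    then show "(\<integral>u. autocorrelation t * cis (- (t * (n * u))) \<partial>?M) = autocorrelation t * of_real (exp (- (t * n)\<^sup>2 / 2))"
      by (simp add: char_std_normal_distribution)
  qed simp
  also have "\<dots> = (1 / n) *\<^sub>R (\<integral>s. autocorrelation (s / n) * of_real (exp (- s\<^sup>2 / 2)) \<partial>lborel)"
    using assms lborel_integral_real_affine[of "1 / n" "\<lambda>t. autocorrelation t * of_real (exp (- (t * n)\<^sup>2 / 2))" 0]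
    by simp
  also have "(\<integral>s. autocorrelation (s / n) * of_real (exp (- s\<^sup>2 / 2)) \<partial>lborel) =
      of_real (sqrt (2 * pi)) * (\<integral>s. autocorrelation (s / n) \<partial>?M)"
  proof -
    have "(\<integral>s. autocorrelation (s / n) \<partial>?M) = (\<integral>s. std_normal_density s *\<^sub>R autocorrelation (s / n) \<partial>lborel)"
      by (rule integral_density) auto
    moreover have "autocorrelation (s / n) * of_real (exp (- s\<^sup>2 / 2)) =
        of_real (sqrt (2 * pi)) * (std_normal_density s *\<^sub>R autocorrelation (s / n))" for s
      by (simp only: gauss scaleR_conv_of_real of_real_mult mult_ac)
    ultimately show ?thesis by (simp only: integral_mult_right_zero)
  qed
  finally have 1: "(\<integral>u. complex_of_real ((cmod (?F (n * u)))\<^sup>2) \<partial>?M) =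
    of_real (1 / (sqrt (2 * pi) * n)) * (\<integral>s. autocorrelation (s / n) \<partial>?M)"
    by (simp only: scaleR_conv_of_real mult.assoc[symmetric] of_real_mult[symmetric] const)
  have "(\<integral>\<xi>. (cmod (?F \<xi>))\<^sup>2 * exp (- (\<xi> / n)\<^sup>2 / 2) \<partial>lborel) =
      n * (\<integral>u. (cmod (?F (n * u)))\<^sup>2 * exp (- u\<^sup>2 / 2) \<partial>lborel)"
    using assms lborel_integral_real_affine[of n "\<lambda>\<xi>. (cmod (?F \<xi>))\<^sup>2 * exp (- (\<xi> / n)\<^sup>2 / 2)" 0]
    by simp
  also have "(\<integral>u. (cmod (?F (n * u)))\<^sup>2 * exp (- u\<^sup>2 / 2) \<partial>lborel) =
      sqrt (2 * pi) * (\<integral>u. (cmod (?F (n * u)))\<^sup>2 \<partial>?M)"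
  proof -
    have "(\<integral>u. (cmod (?F (n * u)))\<^sup>2 \<partial>?M) = (\<integral>u. std_normal_density u *\<^sub>R (cmod (?F (n * u)))\<^sup>2 \<partial>lborel)"
      by (rule integral_density) auto
    moreover have "(cmod (?F (n * u)))\<^sup>2 * exp (- u\<^sup>2 / 2) =
        sqrt (2 * pi) * (std_normal_density u *\<^sub>R (cmod (?F (n * u)))\<^sup>2)" for u
      by (simp only: gauss real_scaleR_def mult_ac)
    ultimately show ?thesis by (simp only: integral_mult_right_zero)
  qed
  finally have "(\<integral>\<xi>. (cmod (?F \<xi>))\<^sup>2 * exp (- (\<xi> / n)\<^sup>2 / 2) \<partial>lborel) =
      of_real (sqrt (2 * pi) * n) * (\<integral>u. complex_of_real ((cmod (?F (n * u)))\<^sup>2) \<partial>?M)"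
    by (simp del: of_real_power add: mult_ac)
  also have "\<dots> = of_real (sqrt (2 * pi) * n * (1 / (sqrt (2 * pi) * n))) *
      (\<integral>s. autocorrelation (s / n) \<partial>?M)"
    unfolding 1 by (simp only: of_real_mult mult.assoc)
  also have "sqrt (2 * pi) * n * (1 / (sqrt (2 * pi) * n)) = 1"
    using assms by simp
  finally show ?thesis by simp
qed

text \<open>
  Let \<open>n\<close> tend to infinity in \<open>gaussian_average\<close>: the weights increase to \<open>1\<close>, and the
  averages of the autocorrelation tend to its value at \<open>0\<close>, which is the squared norm of \<open>\<phi>\<close>. Monotone
  convergence yields both the integrability and the value of the integral.
\<close>

lemma plancherel:
  "square_integrable (fourier_integral \<phi>)"
  "(\<integral>\<xi>. (cmod (fourier_integral \<phi> \<xi>))\<^sup>2 \<partial>lborel) = (\<integral>x. (cmod (\<phi> x))\<^sup>2 \<partial>lborel)"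
proof -
  let ?M = "std_normal_distribution" and ?F = "fourier_integral \<phi>"
  interpret M: real_distribution ?M by (rule real_dist_normal_dist)
  \<comment> \<open>\<open>Suc n\<close> avoids the scale \<open>0\<close>.\<close>
  define G where "G n \<xi> = (cmod (?F \<xi>))\<^sup>2 * exp (- (\<xi> / real (Suc n))\<^sup>2 / 2)" for n \<xi>
  have "(\<lambda>n. \<integral>s. autocorrelation (s / real (Suc n)) \<partial>?M) \<longlonglongrightarrow> (\<integral>s. autocorrelation 0 \<partial>?M)"
  proof (rule integral_dominated_convergence)
    show "integrable ?M (\<lambda>s. 2 * R * K\<^sup>2)" by simp
    show "AE s in ?M. (\<lambda>n. autocorrelation (s / real (Suc n))) \<longlonglongrightarrow> autocorrelation 0"
    proof (intro AE_I2 autocorrelation_tendsto)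
      fix s
      have "(\<lambda>n. s * inverse (real (Suc n))) \<longlonglongrightarrow> s * 0"
        by (intro tendsto_mult tendsto_const LIMSEQ_inverse_real_of_nat)
      then show "(\<lambda>n. s / real (Suc n)) \<longlonglongrightarrow> 0" by (simp add: divide_inverse)
    qed
    show "AE s in ?M. norm (autocorrelation (s / real (Suc n))) \<le> 2 * R * K\<^sup>2" for n
      using R_nonneg
      by (intro AE_I2 order_trans[OF cmod_autocorrelation_le]) (auto simp: indicator_def)
  qed measurable
  then have "(\<lambda>n. complex_of_real (\<integral>\<xi>. G n \<xi> \<partial>lborel)) \<longlonglongrightarrow> of_real (\<integral>x. (cmod (\<phi> x))\<^sup>2 \<partial>lborel)"
    unfolding G_def by (subst gaussian_average) (use M.prob_space in \<open>auto simp: autocorrelation_0\<close>)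
  then have lim: "(\<lambda>n. \<integral>\<xi>. G n \<xi> \<partial>lborel) \<longlonglongrightarrow> (\<integral>x. (cmod (\<phi> x))\<^sup>2 \<partial>lborel)"
    by (simp add: tendsto_of_real_iff)
  obtain B where B: "\<And>\<xi>. cmod (?F \<xi>) \<le> B" using fourier_integral_bounded by blast
  have int: "integrable lborel (G n)" for n
  proof (rule Bochner_Integration.integrable_bound)
    have "integrable lborel (\<lambda>x. std_normal_density (0 + (1 / real (Suc n)) * x))"
      by (intro lborel_integrable_real_affine) auto
    then show "integrable lborel (\<lambda>x. (B\<^sup>2 * sqrt (2 * pi)) * std_normal_density (0 + (1 / real (Suc n)) * x))"
      by (rule integrable_mult_right)
    show "AE \<xi> in lborel. norm (G n \<xi>) \<le> norm ((B\<^sup>2 * sqrt (2 * pi)) * std_normal_density (0 + (1 / real (Suc n)) * \<xi>))"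
    proof (intro AE_I2)
      fix \<xi>
      have "(cmod (?F \<xi>))\<^sup>2 \<le> B\<^sup>2" by (intro power_mono B) simp
      then show "norm (G n \<xi>) \<le> norm ((B\<^sup>2 * sqrt (2 * pi)) * std_normal_density (0 + (1 / real (Suc n)) * \<xi>))"
        by (simp add: G_def std_normal_density_def abs_mult mult_right_mono)
    qed
    show "G n \<in> borel_measurable lborel" unfolding G_def[abs_def] by measurable
  qed
  have mono: "AE \<xi> in lborel. mono (\<lambda>n. G n \<xi>)"
  proof (intro AE_I2 monoI)
    fix \<xi> and m n :: nat assume "m \<le> n"
    then have "\<bar>\<xi> / real (Suc n)\<bar> \<le> \<bar>\<xi> / real (Suc m)\<bar>"
      by (simp add: abs_divide divide_left_mono)
    then have "(\<xi> / real (Suc n))\<^sup>2 \<le> (\<xi> / real (Suc m))\<^sup>2"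
      by (simp only: abs_le_square_iff)
    then show "G m \<xi> \<le> G n \<xi>"
      unfolding G_def by (intro mult_left_mono) auto
  qed
  have ptw: "AE \<xi> in lborel. (\<lambda>n. G n \<xi>) \<longlonglongrightarrow> (cmod (?F \<xi>))\<^sup>2"
  proof (intro AE_I2)
    fix \<xi>
    have "(\<lambda>n. \<xi> * inverse (real (Suc n))) \<longlonglongrightarrow> \<xi> * 0"
      by (intro tendsto_mult tendsto_const LIMSEQ_inverse_real_of_nat)
    then have "(\<lambda>n. \<xi> / real (Suc n)) \<longlonglongrightarrow> 0" by (simp add: divide_inverse)
    then have "(\<lambda>n. G n \<xi>) \<longlonglongrightarrow> (cmod (?F \<xi>))\<^sup>2 * exp (- 0\<^sup>2 / 2)"
      unfolding G_def by (intro tendsto_intros) auto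
    then show "(\<lambda>n. G n \<xi>) \<longlonglongrightarrow> (cmod (?F \<xi>))\<^sup>2" by simp
  qed
  have "(\<lambda>\<xi>. (cmod (?F \<xi>))\<^sup>2) \<in> borel_measurable lborel" by measurable
  note conv = int mono ptw lim this
  show "square_integrable ?F"
    using integrable_monotone_convergence[OF conv] by (simp add: square_integrable_def)
  show "(\<integral>\<xi>. (cmod (?F \<xi>))\<^sup>2 \<partial>lborel) = (\<integral>x. (cmod (\<phi> x))\<^sup>2 \<partial>lborel)"
    by (rule integral_monotone_convergence[OF conv])
qed

end

section \<open>The uncertainty principle\<close>

text \<open>
  The exponential series may be integrated term by term because \<open>x\<close> stays bounded on the
  support of \<open>\<phi>\<close>.
\<close>

lemma fourier_integral_power_series:
  fixes \<phi> :: "real \<Rightarrow> complex" and z :: complex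
  assumes int: "integrable lborel \<phi>" and supp: "\<And>x. \<bar>x\<bar> > R \<Longrightarrow> \<phi> x = 0"
  shows "(\<lambda>n. (\<integral>x. \<phi> x * (- \<i> * x) ^ n / fact n \<partial>lborel) * z ^ n) sums
    (\<integral>x. \<phi> x * exp (- \<i> * x * z) \<partial>lborel)"
proof -
  define f where "f n x = \<phi> x * ((- \<i> * x) ^ n / fact n * z ^ n)" for n and x :: real
  have [measurable]: "\<phi> \<in> borel_measurable borel" using int by auto
  define R' where "R' = max R 0"
  have le: "cmod (f n x) \<le> cmod (\<phi> x) * ((R' * cmod z) ^ n / fact n)" for n x
  proof (cases "\<bar>x\<bar> > R")
    case False
    then have "\<bar>x\<bar> * cmod z \<le> R' * cmod z" by (intro mult_right_mono) (auto simp: R'_def)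
    then have "(\<bar>x\<bar> * cmod z) ^ n / fact n \<le> (R' * cmod z) ^ n / fact n"
      by (intro divide_right_mono power_mono) auto
    then have "cmod (\<phi> x) * ((\<bar>x\<bar> * cmod z) ^ n / fact n) \<le> cmod (\<phi> x) * ((R' * cmod z) ^ n / fact n)"
      by (rule mult_left_mono) simp
    then show ?thesis
      by (simp add: f_def norm_mult norm_divide norm_power power_mult_distrib)
  qed (simp add: f_def supp)
  have int_f: "integrable lborel (f n)" for n
  proof (rule Bochner_Integration.integrable_bound)
    show "integrable lborel (\<lambda>x. cmod (\<phi> x) * ((R' * cmod z) ^ n / fact n))"
      using int by (intro integrable_mult_left integrable_norm)
    show "f n \<in> borel_measurable lborel" unfolding f_def[abs_def] by measurable
    show "AE x in lborel. norm (f n x) \<le> norm (cmod (\<phi> x) * ((R' * cmod z) ^ n / fact n))"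
    proof (intro AE_I2)
      show "norm (f n x) \<le> norm (cmod (\<phi> x) * ((R' * cmod z) ^ n / fact n))" for x
        using order_trans[OF le abs_ge_self] by (simp only: real_norm_def)
    qed
  qed
  have sums_f: "(\<lambda>n. f n x) sums (\<phi> x * exp (- \<i> * x * z))" for x
  proof -
    have eq: "(- \<i> * x) ^ n / fact n * z ^ n = (- \<i> * x * z) ^ n /\<^sub>R fact n" for n
      unfolding power_mult_distrib[of "- \<i> * x" z] by (simp add: scaleR_conv_of_real field_simps)
    have "(\<lambda>n. (- \<i> * x * z) ^ n /\<^sub>R fact n) sums exp (- \<i> * x * z)" by (rule exp_converges)
    from sums_mult[OF this, of "\<phi> x"] show ?thesis
      unfolding f_def eq .
  qed
  have summ: "summable (\<lambda>n. C * ((R' * cmod z) ^ n / fact n))" for C :: real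
    using summable_exp[of "R' * cmod z"] by (intro summable_mult) (simp add: divide_inverse mult.commute)
  have "(\<lambda>n. integral\<^sup>L lborel (f n)) sums (\<integral>x. (\<Sum>n. f n x) \<partial>lborel)"
  proof (rule sums_integral[OF int_f])
    show "AE x in lborel. summable (\<lambda>n. norm (f n x))"
      by (intro AE_I2 summable_comparison_test'[OF summ]) (use le in simp)
    have "(\<integral>x. norm (f n x) \<partial>lborel) \<le> (\<integral>x. cmod (\<phi> x) * ((R' * cmod z) ^ n / fact n) \<partial>lborel)" for n
      using int int_f le by (intro integral_mono integrable_norm integrable_mult_left)
    then have "norm (\<integral>x. norm (f n x) \<partial>lborel) \<le> (\<integral>x. cmod (\<phi> x) \<partial>lborel) * ((R' * cmod z) ^ n / fact n)" for n
      by simp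
    then show "summable (\<lambda>n. \<integral>x. norm (f n x) \<partial>lborel)"
      by (intro summable_comparison_test'[OF summ])
  qed
  moreover have "integral\<^sup>L lborel (f n) = (\<integral>x. \<phi> x * (- \<i> * x) ^ n / fact n \<partial>lborel) * z ^ n" for n
    by (simp add: f_def[abs_def] mult.assoc flip: integral_mult_left_zero)
  moreover have "(\<Sum>n. f n x) = \<phi> x * exp (- \<i> * x * z)" for x
    using sums_f by (rule sums_unique[symmetric])
  ultimately show ?thesis by simp
qed

text \<open>
  The Fourier integral extends to an entire function. Its zeros in a bounded interval
  beyond \<open>S\<close> have full measure there, hence are infinite in number and accumulate.
\<close>

lemma fourier_integral_uncertainty:
  assumes int: "integrable lborel \<phi>" and supp: "\<And>x. \<bar>x\<bar> > R \<Longrightarrow> \<phi> x = 0"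
    and AE0: "AE \<xi> in lborel. S < \<bar>\<xi>\<bar> \<longrightarrow> fourier_integral \<phi> \<xi> = 0"
  shows "fourier_integral \<phi> \<xi> = 0"
proof -
  define \<Phi> where "\<Phi> z = (\<integral>x. \<phi> x * exp (- \<i> * x * z) \<partial>lborel)" for z
  have \<Phi>_eq: "fourier_integral \<phi> \<xi> = 1 / sqrt (2 * pi) * \<Phi> \<xi>" for \<xi>
    by (simp add: fourier_integral_def \<Phi>_def cis_conv_exp mult_ac)
  let ?a = "\<lambda>n. \<integral>x. \<phi> x * (- \<i> * x) ^ n / fact n \<partial>lborel"
  have sums: "(\<lambda>n. ?a n * (z - 0) ^ n) sums \<Phi> z" for z
    unfolding \<Phi>_def diff_zero by (rule fourier_integral_power_series[OF int supp])
  have ball: "\<Phi> holomorphic_on ball 0 r" for r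
    by (rule power_series_holomorphic[of 0 r ?a]) (rule sums)
  have hol: "\<Phi> holomorphic_on UNIV"
  proof -
    have "\<Phi> field_differentiable at z" for z
      by (rule holomorphic_on_imp_differentiable_at[OF ball[of "cmod z + 1"]]) auto
    then show ?thesis by (simp add: holomorphic_on_def)
  qed
  define U where "U = {\<xi>. \<bar>S\<bar> < \<xi> \<and> \<xi> < \<bar>S\<bar> + 1 \<and> \<Phi> (of_real \<xi>) = 0}"
  have "infinite U"
  proof
    assume fin: "finite U"
    then have "AE \<xi> in lborel. \<xi> \<notin> U"
      by (intro AE_not_in) (simp add: countable_finite countable_imp_null_set_lborel)
    with AE0 have "AE \<xi> in lborel. \<xi> \<notin> {\<bar>S\<bar><..<\<bar>S\<bar> + 1}"
      by eventually_elim (auto simp: U_def \<Phi>_eq)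
    then have "emeasure lborel {\<bar>S\<bar><..<\<bar>S\<bar> + 1} = 0"
      by (subst (asm) AE_iff_measurable[where N = "{\<bar>S\<bar><..<\<bar>S\<bar> + 1}"]) auto
    then show False by (simp add: emeasure_lborel_Ioo)
  qed
  then have "infinite (complex_of_real ` U)"
    by (simp add: finite_image_iff inj_on_def)
  moreover have "bounded (complex_of_real ` U)"
    unfolding bounded_iff by (intro exI[of _ "\<bar>S\<bar> + 1"]) (auto simp: U_def)
  ultimately obtain w where w: "w islimpt (complex_of_real ` U)"
    using bounded_infinite_imp_islimpt by blast
  have "\<Phi> z = 0" for z
    by (rule analytic_continuation[OF hol open_UNIV connected_UNIV _ _ w]) (auto simp: U_def)
  then show ?thesis by (simp add: \<Phi>_eq)
qed

section \<open>The Fourier transform of test functions\<close>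

lemma integrable_mult_cis:
  assumes "integrable lborel \<phi>"
  shows "integrable lborel (\<lambda>x. \<phi> x * cis (- (x * \<xi>)))"
proof (rule Bochner_Integration.integrable_bound[OF assms])
  have [measurable]: "\<phi> \<in> borel_measurable borel" using assms by auto
  show "(\<lambda>x. \<phi> x * cis (- (x * \<xi>))) \<in> borel_measurable lborel" by measurable
qed (simp add: norm_mult)

lemma fourier_integral_add:
  assumes "integrable lborel \<phi>" "integrable lborel \<psi>"
  shows "fourier_integral (\<lambda>x. \<phi> x + \<psi> x) = (\<lambda>\<xi>. fourier_integral \<phi> \<xi> + fourier_integral \<psi> \<xi>)"
  using assms by (simp add: fourier_integral_def fun_eq_iff distrib_right distrib_left integrable_mult_cis)

lemma fourier_integral_cmult:
  "fourier_integral (\<lambda>x. c * \<phi> x) = (\<lambda>\<xi>. c * fourier_integral \<phi> \<xi>)"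
  by (simp add: fourier_integral_def fun_eq_iff mult.assoc mult.left_commute)

lemma test_function_plancherel:
  assumes "test_function \<phi>"
  shows "square_integrable (fourier_integral \<phi>)"
    and "norm (abs_l2 (fourier_integral \<phi>)) = norm (abs_l2 \<phi>)"
proof -
  obtain K R where K: "\<And>x. cmod (\<phi> x) \<le> K * indicator {-R..R} x" "K \<ge> 0" "R \<ge> 0"
    using continuous_compact_support[OF test_function_continuous[OF assms]
        test_function_bounded_support[OF assms]] by metis
  interpret continuous_compactly_supported \<phi> K R
    using test_function_continuous[OF assms] K by unfold_locales
  show sq: "square_integrable (fourier_integral \<phi>)" by (rule plancherel)
  have "(norm (abs_l2 (fourier_integral \<phi>)))\<^sup>2 = (norm (abs_l2 \<phi>))\<^sup>2"
    by (simp add: norm_abs_l2 sq test_function_square_integrable[OF assms] plancherel(2))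
  then show "norm (abs_l2 (fourier_integral \<phi>)) = norm (abs_l2 \<phi>)" by simp
qed

text \<open>
  For a compactly supported function the truncations that define the Fourier transform
  are eventually constant up to null sets, so the limit is the Fourier integral itself.
\<close>

lemma fourier_test_function:
  assumes "test_function \<phi>"
  shows "fourier (abs_l2 \<phi>) = abs_l2 (fourier_integral \<phi>)"
proof -
  let ?r = "rep_l2 (abs_l2 \<phi>)"
  obtain R where R: "\<And>x. \<bar>x\<bar> > R \<Longrightarrow> \<phi> x = 0"
    using continuous_compact_support[OF test_function_continuous[OF assms]
        test_function_bounded_support[OF assms]] by metis
  have sq: "square_integrable \<phi>" by (rule test_function_square_integrable[OF assms])
  have "abs_l2 ?r = abs_l2 \<phi>" by (rule abs_rep_l2)
  then have AE_eq: "AE x in lborel. ?r x = \<phi> x"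
    by (simp add: abs_l2_eq_iff square_integrable_rep_l2 sq)
  have [measurable]: "?r \<in> borel_measurable borel" "\<phi> \<in> borel_measurable borel"
    using square_integrable_rep_l2[of "abs_l2 \<phi>"] sq by (simp_all add: square_integrable_def)
  have "fourier_integral (\<lambda>x. indicator {- real n..real n} x * ?r x) = fourier_integral \<phi>"
    if n: "real n \<ge> R" for n
  proof
    fix \<xi>
    have "(\<integral>x. indicator {- real n..real n} x * ?r x * cis (- (x * \<xi>)) \<partial>lborel) =
        (\<integral>x. \<phi> x * cis (- (x * \<xi>)) \<partial>lborel)"
    proof (rule integral_cong_AE)
      show "AE x in lborel. indicator {- real n..real n} x * ?r x * cis (- (x * \<xi>)) = \<phi> x * cis (- (x * \<xi>))"
        using AE_eq
      proof eventually_elim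
        case (elim x)
        then show ?case
          using R[of x] n by (cases "\<bar>x\<bar> \<le> real n") (auto simp: indicator_def)
      qed
    qed measurable
    then show "fourier_integral (\<lambda>x. indicator {- real n..real n} x * ?r x) \<xi> = fourier_integral \<phi> \<xi>"
      by (simp add: fourier_integral_def)
  qed
  then have "\<forall>\<^sub>F n in sequentially.
      abs_l2 (fourier_integral (\<lambda>x. indicator {- real n..real n} x * ?r x)) = abs_l2 (fourier_integral \<phi>)"
    by (intro eventually_sequentiallyI[of "nat \<lceil>R\<rceil>"]) (simp add: nat_ceiling_le_eq)
  then show ?thesis
    unfolding fourier_def by (intro limI tendsto_eventually)
qed

lemma norm_fourier: "f \<in> test_functions \<Longrightarrow> norm (fourier f) = norm f"
  by (auto simp: test_functions_eq fourier_test_function test_function_plancherel)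

lemma fourier_add:
  assumes "f \<in> test_functions" "g \<in> test_functions"
  shows "fourier (f + g) = fourier f + fourier g"
proof -
  obtain \<phi> \<psi> where *: "test_function \<phi>" "f = abs_l2 \<phi>" "test_function \<psi>" "g = abs_l2 \<psi>"
    using assms unfolding test_functions_eq by blast
  then have "fourier (f + g) = fourier (abs_l2 (\<lambda>x. \<phi> x + \<psi> x))"
    by (simp add: abs_l2_add test_function_square_integrable)
  also have "\<dots> = fourier f + fourier g"
    using * by (simp add: fourier_test_function test_function_add fourier_integral_add
        test_function_integrable abs_l2_add test_function_plancherel)
  finally show ?thesis .
qed

lemma fourier_scaleC:
  assumes "f \<in> test_functions"
  shows "fourier (c *\<^sub>C f) = c *\<^sub>C fourier f"
proof -
  obtain \<phi> where *: "test_function \<phi>" "f = abs_l2 \<phi>"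
    using assms unfolding test_functions_eq by blast
  then have "fourier (c *\<^sub>C f) = fourier (abs_l2 (\<lambda>x. c * \<phi> x))"
    by (simp add: abs_l2_scaleC test_function_square_integrable)
  also have "\<dots> = c *\<^sub>C fourier f"
    using * by (simp add: fourier_test_function test_function_cmult fourier_integral_cmult
        abs_l2_scaleC test_function_plancherel)
  finally show ?thesis .
qed

text \<open>
  This is what collapses the domain of \<open>T\<^sup>2\<close>: a test function whose Fourier transform is
  again a test function vanishes. The transform is identically zero by the uncertainty
  principle, and it has the same norm as the function.
\<close>

lemma test_function_and_fourier_imp_zero:
  assumes "f \<in> test_functions" "fourier f \<in> test_functions"
  shows "f = 0"
proof -
  obtain \<phi> \<psi> where \<phi>: "test_function \<phi>" "f = abs_l2 \<phi>" and \<psi>: "test_function \<psi>" "fourier f = abs_l2 \<psi>"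
    using assms unfolding test_functions_eq by blast
  have supp: "\<exists>R. \<forall>x. \<bar>x\<bar> > R \<longrightarrow> \<eta> x = 0" if \<eta>: "test_function \<eta>" for \<eta>
    using continuous_compact_support[OF test_function_continuous[OF \<eta>]
        test_function_bounded_support[OF \<eta>]] by metis
  obtain R S where R: "\<And>x. \<bar>x\<bar> > R \<Longrightarrow> \<phi> x = 0" and S: "\<And>x. \<bar>x\<bar> > S \<Longrightarrow> \<psi> x = 0"
    using supp[OF \<phi>(1)] supp[OF \<psi>(1)] by metis
  have "abs_l2 (fourier_integral \<phi>) = abs_l2 \<psi>"
    using \<phi> \<psi> by (simp add: fourier_test_function)
  then have "AE \<xi> in lborel. fourier_integral \<phi> \<xi> = \<psi> \<xi>"
    using \<phi> \<psi> by (simp add: abs_l2_eq_iff test_function_plancherel test_function_square_integrable)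
  then have "AE \<xi> in lborel. S < \<bar>\<xi>\<bar> \<longrightarrow> fourier_integral \<phi> \<xi> = 0"
    by eventually_elim (simp add: S)
  from fourier_integral_uncertainty[OF test_function_integrable[OF \<phi>(1)] R this]
  have "fourier_integral \<phi> = (\<lambda>\<xi>. 0)" by blast
  then have "fourier f = 0"
    using \<phi> by (simp add: fourier_test_function zero_l2_def)
  then show ?thesis using norm_fourier[OF assms(1)] by simp
qed

section \<open>The operator T and its closure\<close>

lemma op_T_apply:
  "op_T (f, g) = (if f \<in> test_functions \<and> g \<in> test_functions
     then Some (fourier g, (1/2) *\<^sub>C fourier f) else None)"
  by (auto simp: op_T_def op_A_def restrict_map_def)

lemma dom_op_T: "dom op_T = test_functions \<times> test_functions"
  by (auto simp: op_T_apply dom_def split: if_splits)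

lemma the_op_T: "p \<in> dom op_T \<Longrightarrow> the (op_T p) = (fourier (snd p), (1/2) *\<^sub>C fourier (fst p))"
  by (cases p) (auto simp: dom_op_T op_T_apply)

lemma linear_op_T: "linear_operator op_T"
  unfolding linear_operator_def
  by (auto simp: the_op_T dom_op_T zero_prod_def scaleC_prod_def test_functions_zero test_functions_add
      test_functions_scaleC fourier_add fourier_scaleC scaleC_add_right scaleC_scaleC mult.commute)

lemma densely_defined_op_T: "densely_defined op_T"
  by (simp add: densely_defined_def dom_op_T closure_Times closure_test_functions)

text \<open>
  A pair \<open>(f, g)\<close> in the domain of \<open>T\<^sup>2\<close> consists of test functions whose Fourier
  transforms are test functions, so it is zero and the inequality is trivial.
\<close>

lemma paranormal_op_T: "paranormal op_T"
  unfolding paranormal_def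
proof
  fix p assume "p \<in> dom (op_T \<circ>\<^sub>m op_T)"
  then have p: "p \<in> dom op_T" "the (op_T p) \<in> dom op_T"
    by (auto simp: map_comp_def dom_def split: option.splits)
  have half: "2 *\<^sub>C (1/2) *\<^sub>C f = f" for f :: l2
    using scaleR_scaleC[of 1 f] by (simp add: scaleC_scaleC)
  have mem: "fst p \<in> test_functions" "snd p \<in> test_functions"
    "fourier (snd p) \<in> test_functions" "(1/2) *\<^sub>C fourier (fst p) \<in> test_functions"
    using p by (auto simp: the_op_T dom_op_T)
  from test_functions_scaleC[OF mem(4), of 2] have "fourier (fst p) \<in> test_functions"
    by (simp add: half)
  with mem have "p = 0"
    by (simp add: prod_eq_iff test_function_and_fourier_imp_zero)
  moreover have "norm (the (op_T p)) = 0"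
    using p(1) mem(1,2) \<open>p = 0\<close> by (simp add: the_op_T norm_Pair norm_scaleC norm_fourier)
  ultimately show "(norm (the (op_T p)))\<^sup>2 \<le> norm (the ((op_T \<circ>\<^sub>m op_T) p)) * norm p" by simp
qed

text \<open>
  The norm identities hold on the domain of \<open>T\<close> by Plancherel's theorem and extend to all
  of the space by continuity and density. They determine how the norm
  behaves under iteration of the closure.
\<close>

lemma op_T_closure:
  "closable op_T \<and> (\<exists>B. operator_closure op_T = (\<lambda>p. Some (B p)) \<and>
     (\<forall>p. norm (fst (B p)) = norm (snd p) \<and> norm (snd (B p)) = norm (fst p) / 2))"
proof -
  have norms: "norm (fst (the (op_T p))) = norm (snd p)" "norm (snd (the (op_T p))) = norm (fst p) / 2"
    if "p \<in> dom op_T" for p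
    using that by (auto simp: the_op_T dom_op_T norm_fourier norm_scaleC)
  have le: "norm (the (op_T p)) \<le> 1 * norm p" if "p \<in> dom op_T" for p
  proof -
    have "(norm (fst p) / 2)\<^sup>2 \<le> (norm (fst p))\<^sup>2" by (intro power_mono) auto
    then show ?thesis
      unfolding norm_prod_def norms[OF that] mult_1 real_sqrt_le_iff by linarith
  qed
  note closure = bounded_operator_closure[OF linear_op_T densely_defined_op_T le]
  obtain B where cont: "continuous_on UNIV B" and B: "\<forall>p\<in>dom op_T. op_T p = Some (B p)"
    "operator_closure op_T = (\<lambda>p. Some (B p))"
    using closure(2) by blast
  let ?N = "{p. norm (fst (B p)) = norm (snd p) \<and> norm (snd (B p)) = norm (fst p) / 2}"
  have "closed ?N"
    by (intro closed_Collect_conj closed_Collect_eq continuous_on_norm continuous_on_fst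
        continuous_on_snd continuous_on_divide continuous_on_const continuous_on_id cont) auto
  moreover have "dom op_T \<subseteq> ?N" using norms B(1) by force
  ultimately have "closure (dom op_T) \<subseteq> ?N" by (intro closure_minimal)
  then have "p \<in> ?N" for p using densely_defined_op_T by (auto simp: densely_defined_def)
  with B(2) closure(1) show ?thesis by blast
qed

text \<open>
  On a vector \<open>(0, g)\<close> the closure preserves the norm, whereas its square halves it.
\<close>

lemma not_paranormal_closure_op_T: "\<not> paranormal (operator_closure op_T)"
proof
  assume para: "paranormal (operator_closure op_T)"
  obtain B where B: "operator_closure op_T = (\<lambda>p. Some (B p))"
    "\<And>p. norm (fst (B p)) = norm (snd p)" "\<And>p. norm (snd (B p)) = norm (fst p) / 2"
    using op_T_closure by blast
  let ?g = "abs_l2 (ind {0<..<1})"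
  have "(norm ?g)\<^sup>2 = (\<integral>x. (cmod (ind {0<..<1} x))\<^sup>2 \<partial>lborel)"
    by (intro norm_abs_l2 square_integrable_indicator) auto
  also have "\<dots> = (\<integral>x. indicator {0<..<1::real} x \<partial>lborel)"
    by (intro Bochner_Integration.integral_cong) (auto simp: indicator_def)
  finally have g: "(norm ?g)\<^sup>2 = 1" by (simp add: measure_def)
  have norm_B: "(norm (B p))\<^sup>2 = (norm (snd p))\<^sup>2 + (norm (fst p) / 2)\<^sup>2" for p
    by (simp add: norm_prod_def B)
  have "(norm (B p))\<^sup>2 \<le> norm (B (B p)) * norm p" for p
    using para unfolding paranormal_def B(1) by (cases p) (simp add: map_comp_def dom_def)
  then have "(norm (B (0, ?g)))\<^sup>2 \<le> norm (B (B (0, ?g))) * norm (0 :: l2, ?g)" .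
  moreover have "(norm (B (B (0, ?g))))\<^sup>2 = (1/2)\<^sup>2"
    using g by (simp add: norm_B B power_divide)
  then have "norm (B (B (0, ?g))) = 1/2" by (rule power2_eq_imp_eq) auto
  moreover have "(norm (B (0, ?g)))\<^sup>2 = 1" by (simp add: norm_B g)
  moreover have "norm (0 :: l2, ?g) = 1" using power2_eq_imp_eq[of "norm ?g" 1] g by simp
  ultimately show False by simp
qed

theorem mainTheorem2:
  shows "(linear_operator op_T \<and> densely_defined op_T \<and> closable op_T \<and> paranormal op_T \<and>
          \<not> paranormal (operator_closure op_T)) \<and>
         (\<exists>S :: (l2 \<times> l2) operator.
            linear_operator S \<and> densely_defined S \<and> closable S \<and> paranormal S \<and>
            \<not> paranormal (operator_closure S))"
  using linear_op_T densely_defined_op_T op_T_closure paranormal_op_T not_paranormal_closure_op_T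
  by blast

end
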